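(* Let $0<r<1$ and let $T$ be an invertible operator on a Hilbert space $\mathcal H$. Then $T\in C_{1,r}$ if and only if there exist a Hilbert space $\mathcal K$, an isometry $V:\mathcal H\to\mathcal K$ and an invertible operator $J\in\mathcal C_{1,r}$ on $\mathcal K$ such that $T^n=V^*J^nV$ for all integers $n$.
   Context: $C_{1,r}=\{T: T\text{ invertible},\ \|T\|\le1,\ \|rT^{-1}\|\le1\}$. $\mathcal C_{1,r}$ is the class of operators $J$ on a Hilbert space $\mathcal K$ for which there exist orthogonal projections $P_0,P_1$ on $\mathcal K$ with $P_0+P_1=I_{\mathcal K}$ and $J^*J=P_0+r^2P_1$ (equivalently, for invertible $J$, $(1+r^2)I-J^*J-r^2J^{-1}(J^{-1})^*=0$). *)

theory Defs
  imports Complex_Main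
begin

text \<open>Complex Hilbert spaces are represented as explicit structures (carrier set together
with vector operations and an inner product) on some ambient type.  This is needed because
the theorem quantifies existentially over Hilbert spaces, which cannot be done over types.
Convention: the inner product is linear in the first and conjugate linear in the second
argument.\<close>

record 'a hspace =
  hcarrier :: "'a set"
  hadd :: "'a \<Rightarrow> 'a \<Rightarrow> 'a"
  hscale :: "complex \<Rightarrow> 'a \<Rightarrow> 'a"
  hzero :: "'a"
  hinner :: "'a \<Rightarrow> 'a \<Rightarrow> complex"

definition hnorm :: "('a, 'b) hspace_scheme \<Rightarrow> 'a \<Rightarrow> real" where
  "hnorm H x = sqrt (Re (hinner H x x))"

definition hdiff :: "('a, 'b) hspace_scheme \<Rightarrow> 'a \<Rightarrow> 'a \<Rightarrow> 'a" where
  "hdiff H x y = hadd H x (hscale H (-1) y)"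

definition is_hilbert :: "('a, 'b) hspace_scheme \<Rightarrow> bool" where
  "is_hilbert H \<longleftrightarrow>
     hzero H \<in> hcarrier H \<and>
     (\<forall>x\<in>hcarrier H. \<forall>y\<in>hcarrier H. hadd H x y \<in> hcarrier H) \<and>
     (\<forall>a. \<forall>x\<in>hcarrier H. hscale H a x \<in> hcarrier H) \<and>
     (\<forall>x\<in>hcarrier H. \<forall>y\<in>hcarrier H. \<forall>z\<in>hcarrier H.
        hadd H (hadd H x y) z = hadd H x (hadd H y z)) \<and>
     (\<forall>x\<in>hcarrier H. \<forall>y\<in>hcarrier H. hadd H x y = hadd H y x) \<and>
     (\<forall>x\<in>hcarrier H. hadd H x (hzero H) = x) \<and>
     (\<forall>x\<in>hcarrier H. \<exists>y\<in>hcarrier H. hadd H x y = hzero H) \<and>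
     (\<forall>a. \<forall>x\<in>hcarrier H. \<forall>y\<in>hcarrier H.
        hscale H a (hadd H x y) = hadd H (hscale H a x) (hscale H a y)) \<and>
     (\<forall>a b. \<forall>x\<in>hcarrier H. hscale H (a + b) x = hadd H (hscale H a x) (hscale H b x)) \<and>
     (\<forall>a b. \<forall>x\<in>hcarrier H. hscale H a (hscale H b x) = hscale H (a * b) x) \<and>
     (\<forall>x\<in>hcarrier H. hscale H 1 x = x) \<and>
     (\<forall>x\<in>hcarrier H. \<forall>y\<in>hcarrier H. \<forall>z\<in>hcarrier H.
        hinner H (hadd H x y) z = hinner H x z + hinner H y z) \<and>
     (\<forall>a. \<forall>x\<in>hcarrier H. \<forall>y\<in>hcarrier H. hinner H (hscale H a x) y = a * hinner H x y) \<and>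
     (\<forall>x\<in>hcarrier H. \<forall>y\<in>hcarrier H. hinner H y x = cnj (hinner H x y)) \<and>
     (\<forall>x\<in>hcarrier H. 0 \<le> Re (hinner H x x)) \<and>
     (\<forall>x\<in>hcarrier H. hinner H x x = 0 \<longrightarrow> x = hzero H) \<and>
     (\<forall>f :: nat \<Rightarrow> 'a. (\<forall>n. f n \<in> hcarrier H) \<and>
        (\<forall>e>0. \<exists>N. \<forall>m\<ge>N. \<forall>n\<ge>N. hnorm H (hdiff H (f m) (f n)) < e) \<longrightarrow>
        (\<exists>l\<in>hcarrier H. (\<lambda>n. hnorm H (hdiff H (f n) l)) \<longlonglongrightarrow> 0))"

definition is_bop :: "('a, 'b) hspace_scheme \<Rightarrow> ('c, 'd) hspace_scheme \<Rightarrow> ('a \<Rightarrow> 'c) \<Rightarrow> bool" where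
  "is_bop H K T \<longleftrightarrow>
     (\<forall>x\<in>hcarrier H. T x \<in> hcarrier K) \<and>
     (\<forall>x\<in>hcarrier H. \<forall>y\<in>hcarrier H. T (hadd H x y) = hadd K (T x) (T y)) \<and>
     (\<forall>a. \<forall>x\<in>hcarrier H. T (hscale H a x) = hscale K a (T x)) \<and>
     (\<exists>C. \<forall>x\<in>hcarrier H. hnorm K (T x) \<le> C * hnorm H x)"

definition is_operator :: "('a, 'b) hspace_scheme \<Rightarrow> ('a \<Rightarrow> 'a) \<Rightarrow> bool" where
  "is_operator H T \<longleftrightarrow> is_bop H H T"

definition hopnorm :: "('a, 'b) hspace_scheme \<Rightarrow> ('c, 'd) hspace_scheme \<Rightarrow> ('a \<Rightarrow> 'c) \<Rightarrow> real" where
  "hopnorm H K T = Sup {hnorm K (T x) | x. x \<in> hcarrier H \<and> hnorm H x \<le> 1}"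

definition hadj :: "('a, 'b) hspace_scheme \<Rightarrow> ('c, 'd) hspace_scheme \<Rightarrow> ('a \<Rightarrow> 'c) \<Rightarrow> ('c \<Rightarrow> 'a)" where
  "hadj H K T = (SOME A. is_bop K H A \<and>
     (\<forall>x\<in>hcarrier H. \<forall>y\<in>hcarrier K. hinner K (T x) y = hinner H x (A y)))"

definition hinvertible :: "('a, 'b) hspace_scheme \<Rightarrow> ('a \<Rightarrow> 'a) \<Rightarrow> bool" where
  "hinvertible H T \<longleftrightarrow> is_operator H T \<and>
     (\<exists>S. is_operator H S \<and> (\<forall>x\<in>hcarrier H. S (T x) = x \<and> T (S x) = x))"

definition hinv :: "('a, 'b) hspace_scheme \<Rightarrow> ('a \<Rightarrow> 'a) \<Rightarrow> ('a \<Rightarrow> 'a)" where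
  "hinv H T = (SOME S. is_operator H S \<and> (\<forall>x\<in>hcarrier H. S (T x) = x \<and> T (S x) = x))"

definition hzpow :: "('a, 'b) hspace_scheme \<Rightarrow> ('a \<Rightarrow> 'a) \<Rightarrow> int \<Rightarrow> ('a \<Rightarrow> 'a)" where
  "hzpow H T n = (if 0 \<le> n then T ^^ nat n else (hinv H T) ^^ nat (- n))"

definition is_isometry :: "('a, 'b) hspace_scheme \<Rightarrow> ('c, 'd) hspace_scheme \<Rightarrow> ('a \<Rightarrow> 'c) \<Rightarrow> bool" where
  "is_isometry H K V \<longleftrightarrow> is_bop H K V \<and> (\<forall>x\<in>hcarrier H. hnorm K (V x) = hnorm H x)"

definition is_orth_proj :: "('a, 'b) hspace_scheme \<Rightarrow> ('a \<Rightarrow> 'a) \<Rightarrow> bool" where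
  "is_orth_proj H P \<longleftrightarrow> is_operator H P \<and>
     (\<forall>x\<in>hcarrier H. P (P x) = P x) \<and> (\<forall>x\<in>hcarrier H. hadj H H P x = P x)"

definition class_C1r :: "('a, 'b) hspace_scheme \<Rightarrow> real \<Rightarrow> ('a \<Rightarrow> 'a) \<Rightarrow> bool" where
  "class_C1r H r T \<longleftrightarrow> hinvertible H T \<and> hopnorm H H T \<le> 1 \<and>
     hopnorm H H (\<lambda>x. hscale H (complex_of_real r) (hinv H T x)) \<le> 1"

definition class_calC1r :: "('a, 'b) hspace_scheme \<Rightarrow> real \<Rightarrow> ('a \<Rightarrow> 'a) \<Rightarrow> bool" where
  "class_calC1r K r J \<longleftrightarrow> is_operator K J \<and>
     (\<exists>P0 P1. is_orth_proj K P0 \<and> is_orth_proj K P1 \<and>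
        (\<forall>x\<in>hcarrier K. hadd K (P0 x) (P1 x) = x) \<and>
        (\<forall>x\<in>hcarrier K. hadj K K J (J x) =
             hadd K (P0 x) (hscale K (complex_of_real (r\<^sup>2)) (P1 x))))"

end

theory Submission
  imports Defs
begin

text \<open>
  For the direction from the dilation to \<open>T\<close>, \<open>r\<^sup>2 \<le> J\<^sup>* J \<le> 1\<close>, and both bounds pass to the compressions
  \<open>T = V\<^sup>* J V\<close> and \<open>T\<^sup>-\<^sup>1 = V\<^sup>* J\<^sup>-\<^sup>1 V\<close>.

  For the existence of the dilation take \<open>K = H \<oplus> H\<close> and a lower triangular \<open>J\<close> with invertible
  diagonal and first diagonal entry \<open>T\<close>; then every integer power of \<open>J\<close> is lower triangular with
  first entry the power of \<open>T\<close>. Put \<open>A = T\<^sup>* T\<close>, so that \<open>r\<^sup>2 \<le> A \<le> 1\<close>, let \<open>W\<close> be the adjoint of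
  the inverse of \<open>T\<close>, and let \<open>G\<close> be a self-adjoint square root of \<open>(1 - A) (A - r\<^sup>2)\<close> commuting with
  \<open>A\<close>. For \<open>J (x, y) = (T x, W (G x + r y))\<close> the operator \<open>L = J\<^sup>* J\<close> satisfies
  \<open>(L - 1) (L - r\<^sup>2) = 0\<close>, hence \<open>L = P\<^sub>0 + r\<^sup>2 P\<^sub>1\<close> with complementary orthogonal projections. For a
  positive scalar \<open>A = t\<^sup>2\<close> this is the triangular 2 by 2 matrix with singular values \<open>1\<close> and \<open>r\<close>
  and diagonal \<open>t, r / t\<close>.
\<close>

section \<open>Hilbert spaces\<close>

lemma null_seq_bound:
  fixes f :: "nat \<Rightarrow> 'a::real_normed_vector"
  assumes "g \<longlonglongrightarrow> 0" "\<And>n. norm (f n) \<le> g n"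
  shows "f \<longlonglongrightarrow> 0"
proof (rule tendsto_norm_zero_cancel)
  show "(\<lambda>n. norm (f n)) \<longlonglongrightarrow> 0"
    by (rule tendsto_sandwich[OF _ _ tendsto_const assms(1)]) (simp_all add: assms(2))
qed

locale hilbert =
  fixes H :: "('a, 'b) hspace_scheme"
  assumes hilbert: "is_hilbert H"
begin

section \<open>Names for the Hilbert space axioms\<close>

lemmas axioms = hilbert[unfolded is_hilbert_def]
lemmas module_axioms = axioms[THEN conjunct2]
lemmas scalar_axioms = module_axioms[THEN conjunct2, THEN conjunct2, THEN conjunct2,
    THEN conjunct2, THEN conjunct2, THEN conjunct2]
lemmas inner_axioms =
  scalar_axioms[THEN conjunct2, THEN conjunct2, THEN conjunct2, THEN conjunct2]

lemmas zero_closed [simp] = axioms[THEN conjunct1]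
lemmas add_closed [simp] = module_axioms[THEN conjunct1, rule_format]
lemmas scale_closed [simp] = module_axioms[THEN conjunct2, THEN conjunct1, rule_format]
lemmas add_assoc = module_axioms[THEN conjunct2, THEN conjunct2, THEN conjunct1, rule_format]
lemmas add_commute =
  module_axioms[THEN conjunct2, THEN conjunct2, THEN conjunct2, THEN conjunct1, rule_format]
lemmas add_zero_right [simp] =
  module_axioms[THEN conjunct2, THEN conjunct2, THEN conjunct2, THEN conjunct2,
    THEN conjunct1, rule_format]
lemmas scale_left_distrib = scalar_axioms[THEN conjunct2, THEN conjunct1, rule_format]
lemmas scale_one [simp] =
  scalar_axioms[THEN conjunct2, THEN conjunct2, THEN conjunct2, THEN conjunct1, rule_format]
lemmas inner_add_left [simp] = inner_axioms[THEN conjunct1, rule_format]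
lemmas inner_scale_left [simp] = inner_axioms[THEN conjunct2, THEN conjunct1, rule_format]
lemmas inner_commute =
  inner_axioms[THEN conjunct2, THEN conjunct2, THEN conjunct1, rule_format]
lemmas inner_ge_0 =
  inner_axioms[THEN conjunct2, THEN conjunct2, THEN conjunct2, THEN conjunct1, rule_format]
lemmas inner_eq_0D =
  inner_axioms[THEN conjunct2, THEN conjunct2, THEN conjunct2, THEN conjunct2,
    THEN conjunct1, rule_format]

lemma diff_closed [simp]: "x \<in> hcarrier H \<Longrightarrow> y \<in> hcarrier H \<Longrightarrow> hdiff H x y \<in> hcarrier H"
  by (simp add: hdiff_def)

lemma complete:
  assumes "\<And>n. f n \<in> hcarrier H"
    and "\<And>e. e > 0 \<Longrightarrow> \<exists>N. \<forall>m\<ge>N. \<forall>n\<ge>N. hnorm H (hdiff H (f m) (f n)) < e"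
  obtains l where "l \<in> hcarrier H" "(\<lambda>n. hnorm H (hdiff H (f n) l)) \<longlonglongrightarrow> 0"
proof -
  have "\<exists>l\<in>hcarrier H. (\<lambda>n. hnorm H (hdiff H (f n) l)) \<longlonglongrightarrow> 0"
    by (rule inner_axioms[THEN conjunct2, THEN conjunct2, THEN conjunct2, THEN conjunct2,
          THEN conjunct2, THEN spec, of f, THEN mp]) (use assms in auto)
  with that show ?thesis by blast
qed

lemma inner_add_right [simp]:
  assumes "x \<in> hcarrier H" "y \<in> hcarrier H" "z \<in> hcarrier H"
  shows "hinner H z (hadd H x y) = hinner H z x + hinner H z y"
  using assms by (simp add: inner_commute[of _ z])

lemma inner_scale_right [simp]:
  assumes "x \<in> hcarrier H" "y \<in> hcarrier H"
  shows "hinner H y (hscale H a x) = cnj a * hinner H y x"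
  using assms by (simp add: inner_commute[of _ y])

lemma inner_diff_left [simp]:
  "x \<in> hcarrier H \<Longrightarrow> y \<in> hcarrier H \<Longrightarrow> z \<in> hcarrier H \<Longrightarrow>
    hinner H (hdiff H x y) z = hinner H x z - hinner H y z"
  by (simp add: hdiff_def)

lemma inner_diff_right [simp]:
  "x \<in> hcarrier H \<Longrightarrow> y \<in> hcarrier H \<Longrightarrow> z \<in> hcarrier H \<Longrightarrow>
    hinner H z (hdiff H x y) = hinner H z x - hinner H z y"
  by (simp add: hdiff_def)

lemma inner_zero_left [simp]: "z \<in> hcarrier H \<Longrightarrow> hinner H (hzero H) z = 0"
  using inner_add_left[of "hzero H" "hzero H" z] by simp

lemma inner_zero_right [simp]: "z \<in> hcarrier H \<Longrightarrow> hinner H z (hzero H) = 0"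
  by (simp add: inner_commute[of "hzero H" z])

text \<open>Reduces an identity between vectors to identities between complex numbers, which the
  simplifier can settle by arithmetic. Most vector equations below are proved by testing against an
  arbitrary \<open>z\<close>.\<close>

lemma inner_ext:
  assumes x: "x \<in> hcarrier H" and y: "y \<in> hcarrier H"
    and eq: "\<And>z. z \<in> hcarrier H \<Longrightarrow> hinner H x z = hinner H y z"
  shows "x = y"
proof -
  have "hdiff H x y = hzero H"
    using x y eq by (intro inner_eq_0D) auto
  then have "y = hadd H (hadd H x (hscale H (-1) y)) y"
    using y add_commute[of "hzero H" y] by (simp add: hdiff_def)
  also have "\<dots> = hadd H x (hadd H (hscale H (-1) y) (hscale H 1 y))"
    using x y by (simp add: add_assoc)
  also have "\<dots> = hadd H x (hscale H 0 y)"
    using y scale_left_distrib[of y "-1" 1] by simp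
  also have "hscale H 0 y = hzero H"
    using y by (intro inner_eq_0D) auto
  finally show ?thesis using x by simp
qed

lemma inner_self: "x \<in> hcarrier H \<Longrightarrow> hinner H x x = complex_of_real ((hnorm H x)\<^sup>2)"
  using inner_commute[of x x] inner_ge_0[of x] by (simp add: hnorm_def complex_eq_iff)

lemma norm_square: "x \<in> hcarrier H \<Longrightarrow> (hnorm H x)\<^sup>2 = Re (hinner H x x)"
  by (simp add: inner_self)

lemma norm_ge_0 [simp]: "x \<in> hcarrier H \<Longrightarrow> 0 \<le> hnorm H x"
  by (simp add: hnorm_def inner_ge_0)

lemma norm_eq_0_iff: "x \<in> hcarrier H \<Longrightarrow> hnorm H x = 0 \<longleftrightarrow> x = hzero H"
  using inner_eq_0D[of x] by (auto simp: inner_self) (simp add: hnorm_def)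

lemma norm_zero [simp]: "hnorm H (hzero H) = 0"
  by (simp add: norm_eq_0_iff)

lemma norm_scale [simp]:
  assumes "x \<in> hcarrier H"
  shows "hnorm H (hscale H a x) = cmod a * hnorm H x"
proof (rule power2_eq_imp_eq)
  have "hinner H (hscale H a x) (hscale H a x) = (a * cnj a) * hinner H x x"
    using assms by simp
  also have "\<dots> = of_real ((cmod a * hnorm H x)\<^sup>2)"
    using assms by (simp add: inner_self power_mult_distrib flip: complex_norm_square)
  finally have "hinner H (hscale H a x) (hscale H a x) = of_real ((cmod a * hnorm H x)\<^sup>2)" .
  then show "(hnorm H (hscale H a x))\<^sup>2 = (cmod a * hnorm H x)\<^sup>2"
    using assms by (simp add: norm_square)
qed (use assms in auto)

lemma cauchy_schwarz:
  assumes x: "x \<in> hcarrier H" and y: "y \<in> hcarrier H"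
  shows "cmod (hinner H x y) \<le> hnorm H x * hnorm H y"
proof (cases "y = hzero H")
  case True
  then show ?thesis using x by simp
next
  case False
  define N where "N = hnorm H y"
  define M where "M = hnorm H x"
  define c where "c = hinner H x y"
  have N: "N > 0" using False y norm_eq_0_iff[of y] norm_ge_0[of y] by (simp add: N_def less_le)
  \<comment> \<open>Up to the factor \<open>N\<^sup>2\<close>, \<open>u\<close> is the component of
    \<open>x\<close> orthogonal to \<open>y\<close>; the scaling avoids a division. Nonnegativity of
    its squared norm gives the inequality.\<close>
  define u where "u = hdiff H (hscale H (of_real (N\<^sup>2)) x) (hscale H c y)"
  have u: "u \<in> hcarrier H" using x y by (simp add: u_def)
  have yx: "hinner H y x = cnj c" using x y inner_commute[of x y] by (simp add: c_def)
  have xy: "hinner H x y = c" by (simp add: c_def)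
  have yy: "hinner H y y = of_real (N\<^sup>2)" and xx: "hinner H x x = of_real (M\<^sup>2)"
    using x y by (simp_all add: inner_self N_def M_def)
  have cc: "c * cnj c = of_real ((cmod c)\<^sup>2)" by (rule complex_norm_square[symmetric])
  have "hinner H u u = of_real (N\<^sup>2) * (of_real (N\<^sup>2) * of_real (M\<^sup>2) - c * cnj c)"
    using x y by (simp add: u_def xx yy xy yx algebra_simps)
  also have "\<dots> = of_real (N\<^sup>2 * (N\<^sup>2 * M\<^sup>2 - (cmod c)\<^sup>2))"
    unfolding cc by simp
  finally have uu: "hinner H u u = of_real (N\<^sup>2 * (N\<^sup>2 * M\<^sup>2 - (cmod c)\<^sup>2))" .
  have "0 \<le> N\<^sup>2 * (N\<^sup>2 * M\<^sup>2 - (cmod c)\<^sup>2)"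
    using inner_ge_0[OF u] unfolding uu Re_complex_of_real .
  moreover have "0 < N\<^sup>2" using N by (rule zero_less_power)
  ultimately have "0 \<le> N\<^sup>2 * M\<^sup>2 - (cmod c)\<^sup>2" by (simp only: zero_le_mult_iff) linarith
  then have "(cmod c)\<^sup>2 \<le> (M * N)\<^sup>2"
    by (simp add: power_mult_distrib mult.commute)
  then show ?thesis
    unfolding c_def M_def N_def using x y by - (rule power2_le_imp_le, auto)
qed

text \<open>A vector is estimated by testing it against itself and cancelling one factor of its
  norm. \<open>0 \<le> c\<close> covers norm zero, where nothing can be cancelled.\<close>

lemma norm_le_if_inner_le:
  assumes x: "x \<in> hcarrier H" and "0 \<le> c" and "cmod (hinner H x x) \<le> c * hnorm H x"
  shows "hnorm H x \<le> c"
proof (cases "hnorm H x = 0")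
  case False
  then have "hnorm H x > 0" using x by (simp add: less_le)
  moreover have "hnorm H x * hnorm H x \<le> c * hnorm H x"
    using assms by (simp add: inner_self norm_mult power2_eq_square)
  ultimately show ?thesis by simp
qed (use assms in auto)

lemma norm_triangle:
  assumes x: "x \<in> hcarrier H" and y: "y \<in> hcarrier H"
  shows "hnorm H (hadd H x y) \<le> hnorm H x + hnorm H y"
proof (rule norm_le_if_inner_le)
  let ?s = "hadd H x y"
  have "cmod (hinner H ?s ?s) = cmod (hinner H x ?s + hinner H y ?s)"
    using x y inner_add_left[of x y ?s] by (simp del: inner_add_left inner_add_right)
  also have "\<dots> \<le> hnorm H x * hnorm H ?s + hnorm H y * hnorm H ?s"
    by (intro norm_triangle_le add_mono cauchy_schwarz) (use x y in auto)
  finally show "cmod (hinner H ?s ?s) \<le> (hnorm H x + hnorm H y) * hnorm H ?s"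
    by (simp add: distrib_right)
qed (use x y in auto)

section \<open>Continuity of the inner product\<close>

lemma tendsto_inner_left:
  assumes "\<And>n. f n \<in> hcarrier H" "l \<in> hcarrier H" "z \<in> hcarrier H"
    and "(\<lambda>n. hnorm H (hdiff H (f n) l)) \<longlonglongrightarrow> 0"
  shows "(\<lambda>n. hinner H (f n) z) \<longlonglongrightarrow> hinner H l z"
proof -
  have "(\<lambda>n. hnorm H (hdiff H (f n) l) * hnorm H z) \<longlonglongrightarrow> 0"
    by (intro tendsto_mult_left_zero assms)
  moreover have "norm (hinner H (f n) z - hinner H l z) \<le> hnorm H (hdiff H (f n) l) * hnorm H z" for n
    using cauchy_schwarz[of "hdiff H (f n) l" z] assms by simp
  ultimately have "(\<lambda>n. hinner H (f n) z - hinner H l z) \<longlonglongrightarrow> 0"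
    by (rule null_seq_bound)
  then show ?thesis by (rule LIM_zero_cancel)
qed

lemma tendsto_inner:
  assumes f: "\<And>n. f n \<in> hcarrier H" "l \<in> hcarrier H" "(\<lambda>n. hnorm H (hdiff H (f n) l)) \<longlonglongrightarrow> 0"
    and g: "\<And>n. g n \<in> hcarrier H" "m \<in> hcarrier H" "(\<lambda>n. hnorm H (hdiff H (g n) m)) \<longlonglongrightarrow> 0"
  shows "(\<lambda>n. hinner H (f n) (g n)) \<longlonglongrightarrow> hinner H l m"
proof -
  have "(\<lambda>n. hnorm H (hdiff H (f n) l) * hnorm H (hdiff H (g n) m)) \<longlonglongrightarrow> 0"
    by (intro tendsto_mult_zero assms)
  moreover have "norm (hinner H (hdiff H (f n) l) (hdiff H (g n) m))
      \<le> hnorm H (hdiff H (f n) l) * hnorm H (hdiff H (g n) m)" for n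
    using assms by (intro cauchy_schwarz) auto
  ultimately have 0: "(\<lambda>n. hinner H (hdiff H (f n) l) (hdiff H (g n) m)) \<longlonglongrightarrow> 0"
    by (rule null_seq_bound)
  have 1: "(\<lambda>n. hinner H (f n) m) \<longlonglongrightarrow> hinner H l m"
    using assms by (intro tendsto_inner_left)
  have "(\<lambda>n. cnj (hinner H (g n) l)) \<longlonglongrightarrow> cnj (hinner H m l)"
    using assms by (intro tendsto_cnj tendsto_inner_left)
  then have 2: "(\<lambda>n. hinner H l (g n)) \<longlonglongrightarrow> hinner H l m"
    using assms by (simp add: inner_commute[of _ l])
  \<comment> \<open>Expanding the product of differences and adding back the one-sided terms leaves
    \<open>hinner H (f n) (g n)\<close>.\<close>
  have "(\<lambda>n. hinner H (hdiff H (f n) l) (hdiff H (g n) m)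
          + hinner H (f n) m + hinner H l (g n) - hinner H l m) \<longlonglongrightarrow>
        0 + hinner H l m + hinner H l m - hinner H l m"
    by (intro tendsto_intros 0 1 2)
  then show ?thesis using assms by (simp add: algebra_simps)
qed

text \<open>The representing vector minimises \<open>\<parallel>x\<parallel>\<^sup>2 - 2 Re (f x)\<close>; by the parallelogram
  law every minimising sequence is Cauchy.\<close>

theorem riesz:
  assumes add: "\<And>x y. x \<in> hcarrier H \<Longrightarrow> y \<in> hcarrier H \<Longrightarrow> f (hadd H x y) = f x + f y"
    and scale: "\<And>a x. x \<in> hcarrier H \<Longrightarrow> f (hscale H a x) = a * f x"
    and bound: "\<And>x. x \<in> hcarrier H \<Longrightarrow> cmod (f x) \<le> C * hnorm H x"
  shows "\<exists>m\<in>hcarrier H. \<forall>x\<in>hcarrier H. f x = hinner H x m"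
proof -
  define \<Phi> where "\<Phi> x = (hnorm H x)\<^sup>2 - 2 * Re (f x)" for x
  have \<Phi>: "\<Phi> x = Re (hinner H x x) - 2 * Re (f x)" if "x \<in> hcarrier H" for x
    using that by (simp add: \<Phi>_def norm_square)
  \<comment> \<open>Completing the square in \<open>hnorm H x\<close> bounds the functional below,
    so its infimum is finite.\<close>
  have lower: "- C\<^sup>2 \<le> \<Phi> x" if "x \<in> hcarrier H" for x
  proof -
    have "Re (f x) \<le> C * hnorm H x"
      using bound[OF that] complex_Re_le_cmod order_trans by blast
    moreover have "0 \<le> (hnorm H x - C)\<^sup>2" by simp
    ultimately show ?thesis unfolding \<Phi>_def by (simp add: power2_eq_square algebra_simps)
  qed
  define I where "I = Inf (\<Phi> ` hcarrier H)"
  have bdd: "bdd_below (\<Phi> ` hcarrier H)" using lower by (intro bdd_belowI2) auto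
  have I_le: "I \<le> \<Phi> x" if "x \<in> hcarrier H" for x
    unfolding I_def using that bdd by (intro cInf_lower) auto
  have "\<exists>x\<in>hcarrier H. \<Phi> x < I + 1 / Suc n" for n
  proof -
    have "\<Phi> ` hcarrier H \<noteq> {}" using zero_closed by blast
    from cInf_lessD[OF this, of "I + 1 / Suc n"] show ?thesis by (auto simp: I_def)
  qed
  then obtain s where s: "s n \<in> hcarrier H" and s_less: "\<Phi> (s n) < I + 1 / Suc n" for n
    by metis
  \<comment> \<open>The linear terms cancel in this form of the parallelogram law. Since the
    midpoint has value at least \<open>I\<close>, nearly minimal vectors are close to each
    other.\<close>
  have par: "(hnorm H (hdiff H x y))\<^sup>2 = 2 * \<Phi> x + 2 * \<Phi> y - 4 * \<Phi> (hscale H (1/2) (hadd H x y))"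
    if "x \<in> hcarrier H" "y \<in> hcarrier H" for x y
    using that by (simp add: norm_square \<Phi> add scale algebra_simps)
  have close: "(hnorm H (hdiff H (s m) (s n)))\<^sup>2 < 2 / Suc m + 2 / Suc n" for m n
    using par[OF s s, of m n] s_less[of m] s_less[of n]
      I_le[of "hscale H (1/2) (hadd H (s m) (s n))"] s by simp
  have "\<exists>N. \<forall>m\<ge>N. \<forall>n\<ge>N. hnorm H (hdiff H (s m) (s n)) < e" if "e > 0" for e
  proof -
    have "0 < e\<^sup>2 / 4" using that by simp
    then obtain N where N: "1 / Suc N < e\<^sup>2 / 4" by (rule nat_approx_posE)
    have "hnorm H (hdiff H (s m) (s n)) < e" if "m \<ge> N" "n \<ge> N" for m n
    proof (rule power2_less_imp_less)
      have "1 / real (Suc m) \<le> 1 / Suc N" "1 / real (Suc n) \<le> 1 / Suc N"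
        using that by (auto intro!: divide_left_mono)
      then show "(hnorm H (hdiff H (s m) (s n)))\<^sup>2 < e\<^sup>2"
        using close[of m n] N by simp
    qed (use \<open>e > 0\<close> in simp)
    then show ?thesis by blast
  qed
  from complete[OF s this] obtain m
    where m: "m \<in> hcarrier H" and lim: "(\<lambda>n. hnorm H (hdiff H (s n) m)) \<longlonglongrightarrow> 0" by blast
  have re_eq: "Re (f v) = Re (hinner H v m)" if v: "v \<in> hcarrier H" for v
  proof -
    define c where "c = Re (hinner H m v) - Re (f v)"
    define N where "N = Re (hinner H v v)"
    have N: "N \<ge> 0" using v by (simp add: N_def inner_ge_0)
    \<comment> \<open>First variation at the minimiser. The competitor is \<open>s n + t v\<close>
      rather than \<open>m + t v\<close>, so that only inner products have to pass to the
      limit.\<close>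
    have ge: "0 \<le> t\<^sup>2 * N + 2 * t * c" for t :: real
    proof -
      have eq: "\<Phi> (hadd H (s n) (hscale H (of_real t) v)) =
          \<Phi> (s n) + t\<^sup>2 * N + 2 * t * (Re (hinner H (s n) v) - Re (f v))" for n
        using s[of n] v inner_commute[of v "s n"]
        by (simp add: \<Phi> add scale N_def power2_eq_square algebra_simps)
      have "- (1 / Suc n) \<le> t\<^sup>2 * N + 2 * t * (Re (hinner H (s n) v) - Re (f v))" for n
        using s_less[of n] I_le[of "hadd H (s n) (hscale H (of_real t) v)"] s v by (simp add: eq)
      moreover have "(\<lambda>n. t\<^sup>2 * N + 2 * t * (Re (hinner H (s n) v) - Re (f v)))
          \<longlonglongrightarrow> t\<^sup>2 * N + 2 * t * c"
        unfolding c_def by (intro tendsto_intros tendsto_inner_left s m v lim)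
      moreover have "(\<lambda>n. - (1 / real (Suc n))) \<longlonglongrightarrow> - 0"
        using LIMSEQ_inverse_real_of_nat by (intro tendsto_minus) (simp add: inverse_eq_divide)
      ultimately show ?thesis by (intro LIMSEQ_le[of "\<lambda>n. - (1 / real (Suc n))"]) auto
    qed
    \<comment> \<open>The choice \<open>t = - k\<close> makes the quadratic equal to
      \<open>- (k\<^sup>2 * (N + 2))\<close>, which forces \<open>c = 0\<close>. Dividing by
      \<open>N + 1\<close> instead of \<open>N\<close> includes vectors \<open>v\<close> of norm
      zero.\<close>
    define k where "k = c / (N + 1)"
    have c: "c = k * (N + 1)" using N by (simp add: k_def)
    have "0 \<le> (- k)\<^sup>2 * N + 2 * (- k) * c" by (rule ge)
    also have "\<dots> = - (k\<^sup>2 * (N + 2))"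
      unfolding c by (simp add: power2_eq_square algebra_simps)
    finally have "k\<^sup>2 * (N + 2) \<le> 0" by simp
    then have "c = 0" using N c by (simp add: mult_le_0_iff)
    then show ?thesis using inner_commute[of v m] v m by (simp add: c_def)
  qed
  \<comment> \<open>The imaginary part at \<open>x\<close> is recovered from the real part at
    \<open>hscale H \<i> x\<close>.\<close>
  have "f x = hinner H x m" if "x \<in> hcarrier H" for x
    using re_eq[of x] re_eq[of "hscale H \<i> x"] that m by (simp add: scale complex_eq_iff)
  with m show ?thesis by blast
qed

end

section \<open>Bounded operators and adjoints\<close>

lemma is_bop_closed: "is_bop H K T \<Longrightarrow> x \<in> hcarrier H \<Longrightarrow> T x \<in> hcarrier K"
  and is_bop_add: "is_bop H K T \<Longrightarrow> x \<in> hcarrier H \<Longrightarrow> y \<in> hcarrier H \<Longrightarrow>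
    T (hadd H x y) = hadd K (T x) (T y)"
  and is_bop_scale: "is_bop H K T \<Longrightarrow> x \<in> hcarrier H \<Longrightarrow> T (hscale H a x) = hscale K a (T x)"
  by (simp_all add: is_bop_def)

lemma is_bop_diff:
  assumes "hilbert H" "is_bop H K T" "x \<in> hcarrier H" "y \<in> hcarrier H"
  shows "T (hdiff H x y) = hdiff K (T x) (T y)"
  using assms by (simp add: hdiff_def is_bop_add[OF assms(2)] is_bop_scale[OF assms(2)] hilbert.scale_closed)

text \<open>Later estimates multiply inequalities by the bound and want it nonnegative; the absolute
  value of any bound serves.\<close>

lemma is_bop_bounded:
  assumes "hilbert H" "is_bop H K T"
  shows "\<exists>C\<ge>0. \<forall>x\<in>hcarrier H. hnorm K (T x) \<le> C * hnorm H x"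
proof -
  obtain C where C: "\<forall>x\<in>hcarrier H. hnorm K (T x) \<le> C * hnorm H x"
    using assms(2) by (auto simp: is_bop_def)
  have "hnorm K (T x) \<le> \<bar>C\<bar> * hnorm H x" if "x \<in> hcarrier H" for x
  proof -
    have "hnorm K (T x) \<le> C * hnorm H x" using C that by blast
    also have "\<dots> \<le> \<bar>C\<bar> * hnorm H x"
      using hilbert.norm_ge_0[OF assms(1) that] by (rule mult_right_mono[rotated]) simp
    finally show ?thesis .
  qed
  then show ?thesis by (intro exI[of _ "\<bar>C\<bar>"]) simp
qed

lemma is_bop_comp:
  assumes "hilbert G" "hilbert H" "is_bop G H S" "is_bop H K T"
  shows "is_bop G K (\<lambda>x. T (S x))"
proof -
  obtain C where C: "C \<ge> 0" "\<And>x. x \<in> hcarrier H \<Longrightarrow> hnorm K (T x) \<le> C * hnorm H x"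
    using is_bop_bounded[OF assms(2,4)] by blast
  obtain D where D: "D \<ge> 0" "\<And>x. x \<in> hcarrier G \<Longrightarrow> hnorm H (S x) \<le> D * hnorm G x"
    using is_bop_bounded[OF assms(1,3)] by blast
  have "hnorm K (T (S x)) \<le> (C * D) * hnorm G x" if "x \<in> hcarrier G" for x
    using C(2)[of "S x"] mult_left_mono[OF D(2)[OF that] C(1)] is_bop_closed[OF assms(3) that]
    by (simp add: mult.assoc)
  then have "\<exists>C. \<forall>x\<in>hcarrier G. hnorm K (T (S x)) \<le> C * hnorm G x" by blast
  then show ?thesis
    using assms(3,4) by (simp add: is_bop_def)
qed

lemma hinv_works:
  assumes "hinvertible H T"
  shows "is_operator H (hinv H T)"
    and "x \<in> hcarrier H \<Longrightarrow> hinv H T (T x) = x"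
    and "x \<in> hcarrier H \<Longrightarrow> T (hinv H T x) = x"
proof -
  let ?P = "\<lambda>S. is_operator H S \<and> (\<forall>x\<in>hcarrier H. S (T x) = x \<and> T (S x) = x)"
  obtain S where "?P S" using assms unfolding hinvertible_def by blast
  then have "?P (SOME S. ?P S)" by (rule someI[of ?P])
  then have "?P (hinv H T)" unfolding hinv_def .
  then show "is_operator H (hinv H T)"
    and "x \<in> hcarrier H \<Longrightarrow> hinv H T (T x) = x"
    and "x \<in> hcarrier H \<Longrightarrow> T (hinv H T x) = x" by auto
qed

lemma hinv_eqI:
  assumes "hinvertible H T" "y \<in> hcarrier H" "T y = x"
  shows "hinv H T x = y"
  using hinv_works(2)[OF assms(1,2)] assms(3) by simp

text \<open>Trades the supremum over the unit ball for a homogeneous estimate by normalising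
  vectors. Boundedness of \<open>T\<close> makes the supremum genuine: \<open>Sup\<close> of an
  unbounded set of reals carries no information.\<close>

lemma hopnorm_le_iff:
  assumes "hilbert H" "hilbert K" and T: "is_bop H K T" and "0 \<le> c"
  shows "hopnorm H K T \<le> c \<longleftrightarrow> (\<forall>x\<in>hcarrier H. hnorm K (T x) \<le> c * hnorm H x)"
proof -
  interpret H: hilbert H by fact
  interpret K: hilbert K by fact
  let ?S = "{hnorm K (T x) | x. x \<in> hcarrier H \<and> hnorm H x \<le> 1}"
  have "hnorm K (T (hzero H)) \<in> ?S"
    by (intro CollectI exI[of _ "hzero H"]) simp
  then have ne: "?S \<noteq> {}" by blast
  obtain C where C: "C \<ge> 0" "\<And>x. x \<in> hcarrier H \<Longrightarrow> hnorm K (T x) \<le> C * hnorm H x"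
    using is_bop_bounded[OF \<open>hilbert H\<close> T] by blast
  have bdd: "bdd_above ?S"
  proof (rule bdd_aboveI)
    fix y assume "y \<in> ?S"
    then obtain x where "y = hnorm K (T x)" "x \<in> hcarrier H" "hnorm H x \<le> 1" by blast
    then show "y \<le> C" using C mult_left_le[of "hnorm H x" C] by fastforce
  qed
  show ?thesis
  proof (intro iffI ballI)
    fix x assume le: "hopnorm H K T \<le> c" and x: "x \<in> hcarrier H"
    show "hnorm K (T x) \<le> c * hnorm H x"
    proof (cases "hnorm H x = 0")
      case True
      then show ?thesis using C(2)[OF x] by simp
    next
      case False
      then have pos: "hnorm H x > 0" using x by (simp add: less_le)
      define u where "u = hscale H (of_real (1 / hnorm H x)) x"
      have u: "u \<in> hcarrier H" "hnorm H u \<le> 1"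
        using x pos by (simp_all add: u_def norm_divide)
      then have "hnorm K (T u) \<in> ?S" by blast
      then have "hnorm K (T u) \<le> c"
        using cSup_upper[OF _ bdd] le unfolding hopnorm_def by fastforce
      moreover have "hnorm K (T u) = hnorm K (T x) / hnorm H x"
        using x pos T by (simp add: u_def is_bop_scale[OF T] is_bop_closed[OF T] norm_divide)
      ultimately show ?thesis using pos by (simp add: field_simps)
    qed
  next
    assume *: "\<forall>x\<in>hcarrier H. hnorm K (T x) \<le> c * hnorm H x"
    show "hopnorm H K T \<le> c" unfolding hopnorm_def
    proof (rule cSup_least[OF ne])
      fix y assume "y \<in> ?S"
      then obtain x where "y = hnorm K (T x)" "x \<in> hcarrier H" "hnorm H x \<le> 1" by blast
      then show "y \<le> c" using * mult_left_le[of "hnorm H x" c] \<open>0 \<le> c\<close> by fastforce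
    qed
  qed
qed

locale hilbert_pair = H: hilbert H + K: hilbert K
  for H :: "('a, 'b) hspace_scheme" and K :: "('c, 'd) hspace_scheme"
begin

text \<open>The adjoint relation alone forces linearity, by testing against arbitrary vectors, and
  boundedness, by putting \<open>x = A y\<close> and applying Cauchy-Schwarz.\<close>

lemma is_bop_adjointI:
  assumes T: "is_bop H K T" and closed: "\<And>y. y \<in> hcarrier K \<Longrightarrow> A y \<in> hcarrier H"
    and adj: "\<And>x y. x \<in> hcarrier H \<Longrightarrow> y \<in> hcarrier K \<Longrightarrow> hinner K (T x) y = hinner H x (A y)"
  shows "is_bop K H A"
proof -
  have adj': "hinner H (A y) x = hinner K y (T x)" if "x \<in> hcarrier H" "y \<in> hcarrier K" for x y
    using that adj[OF that] H.inner_commute[of x "A y"] K.inner_commute[of "T x" y]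
      is_bop_closed[OF T] closed by simp
  obtain C where C: "C \<ge> 0" "\<And>x. x \<in> hcarrier H \<Longrightarrow> hnorm K (T x) \<le> C * hnorm H x"
    using is_bop_bounded[OF H.hilbert_axioms T] by blast
  have "hnorm H (A y) \<le> C * hnorm K y" if y: "y \<in> hcarrier K" for y
  proof (rule H.norm_le_if_inner_le)
    have "cmod (hinner H (A y) (A y)) \<le> hnorm K (T (A y)) * hnorm K y"
      using y closed adj[of "A y" y] K.cauchy_schwarz[of "T (A y)" y] T by (simp add: is_bop_closed[OF T])
    also have "\<dots> \<le> (C * hnorm H (A y)) * hnorm K y"
      using y closed C by (intro mult_right_mono) auto
    finally show "cmod (hinner H (A y) (A y)) \<le> C * hnorm K y * hnorm H (A y)"
      by (simp add: mult_ac)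
  qed (use y C closed in auto)
  moreover have "A (hadd K x y) = hadd H (A x) (A y)" if "x \<in> hcarrier K" "y \<in> hcarrier K" for x y
    using that T by (intro H.inner_ext) (simp_all add: closed adj' is_bop_closed[OF T])
  moreover have "A (hscale K a x) = hscale H a (A x)" if "x \<in> hcarrier K" for a x
    using that T by (intro H.inner_ext) (simp_all add: closed adj' is_bop_closed[OF T])
  ultimately show ?thesis using closed unfolding is_bop_def by blast
qed

text \<open>Inner products separate vectors, so the choice made in \<open>hadj\<close> must agree on
  the carrier with any explicit candidate.\<close>

lemma hadj_eqI:
  assumes "is_bop K H A"
    and "\<And>x y. x \<in> hcarrier H \<Longrightarrow> y \<in> hcarrier K \<Longrightarrow> hinner K (T x) y = hinner H x (A y)"
    and y: "y \<in> hcarrier K"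
  shows "hadj H K T y = A y"
proof -
  let ?P = "\<lambda>A. is_bop K H A \<and>
     (\<forall>x\<in>hcarrier H. \<forall>y\<in>hcarrier K. hinner K (T x) y = hinner H x (A y))"
  have "?P A" using assms by blast
  then have "?P (SOME A. ?P A)" by (rule someI[of ?P])
  then have "?P (hadj H K T)" unfolding hadj_def .
  then have bop: "is_bop K H (hadj H K T)"
    and eq: "x \<in> hcarrier H \<Longrightarrow> hinner H x (hadj H K T y) = hinner H x (A y)" for x
    using assms by auto
  show ?thesis
  proof (rule H.inner_ext)
    show closed: "hadj H K T y \<in> hcarrier H" "A y \<in> hcarrier H"
      using is_bop_closed[OF bop y] is_bop_closed[OF assms(1) y] .
    show "hinner H (hadj H K T y) z = hinner H (A y) z" if "z \<in> hcarrier H" for z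
      using eq[OF that] that closed by (simp add: H.inner_commute[of z])
  qed
qed

text \<open>For fixed \<open>y\<close> the functional sending \<open>x\<close> to
  \<open>hinner K (T x) y\<close> is bounded, and Riesz represents it by a vector. Choosing such a
  vector for every \<open>y\<close> gives an adjoint.\<close>

lemma hadj_works:
  assumes T: "is_bop H K T"
  shows is_bop_hadj: "is_bop K H (hadj H K T)"
    and inner_hadj_right: "x \<in> hcarrier H \<Longrightarrow> y \<in> hcarrier K \<Longrightarrow>
      hinner H x (hadj H K T y) = hinner K (T x) y"
    and inner_hadj_left: "x \<in> hcarrier H \<Longrightarrow> y \<in> hcarrier K \<Longrightarrow>
      hinner H (hadj H K T y) x = hinner K y (T x)"
proof -
  obtain C where C: "C \<ge> 0" "\<And>x. x \<in> hcarrier H \<Longrightarrow> hnorm K (T x) \<le> C * hnorm H x"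
    using is_bop_bounded[OF H.hilbert_axioms T] by blast
  have "\<exists>m\<in>hcarrier H. \<forall>x\<in>hcarrier H. hinner K (T x) y = hinner H x m" if y: "y \<in> hcarrier K" for y
  proof (rule H.riesz)
    fix x assume x: "x \<in> hcarrier H"
    have "cmod (hinner K (T x) y) \<le> hnorm K (T x) * hnorm K y"
      using x y by (rule K.cauchy_schwarz[OF is_bop_closed[OF T]])
    also have "\<dots> \<le> (C * hnorm H x) * hnorm K y"
      using x y C by (intro mult_right_mono) auto
    finally show "cmod (hinner K (T x) y) \<le> (C * hnorm K y) * hnorm H x" by (simp add: mult_ac)
  qed (use y T in \<open>simp_all add: is_bop_closed[OF T] is_bop_add[OF T] is_bop_scale[OF T]\<close>)
  then have "\<forall>y\<in>hcarrier K. \<exists>m. m \<in> hcarrier H \<and> (\<forall>x\<in>hcarrier H. hinner K (T x) y = hinner H x m)"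
    by blast
  from bchoice[OF this] obtain A
    where A: "\<forall>y\<in>hcarrier K. A y \<in> hcarrier H \<and> (\<forall>x\<in>hcarrier H. hinner K (T x) y = hinner H x (A y))"
    by (rule exE)
  have bop: "is_bop K H A" by (rule is_bop_adjointI[OF T]) (simp_all add: A)
  have eq: "hadj H K T y = A y" if "y \<in> hcarrier K" for y
    by (rule hadj_eqI[OF bop _ that]) (simp add: A)
  show bop': "is_bop K H (hadj H K T)"
    by (rule is_bop_adjointI[OF T]) (simp_all add: A eq)
  show *: "x \<in> hcarrier H \<Longrightarrow> y \<in> hcarrier K \<Longrightarrow>
      hinner H x (hadj H K T y) = hinner K (T x) y" for x y
    by (simp add: A eq)
  show "hinner H (hadj H K T y) x = hinner K y (T x)" if "x \<in> hcarrier H" "y \<in> hcarrier K"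
    using that *[OF that] H.inner_commute[of x "hadj H K T y"] K.inner_commute[of "T x" y] T
      is_bop_closed[OF bop']
    by (simp add: is_bop_closed[OF T])
qed

end

section \<open>Square roots of positive operators\<close>

text \<open>Symmetry is stated with the inner product rather than with \<open>hadj\<close>, which
  keeps the choice operator out of the arguments below.\<close>

definition self_adjoint :: "('a, 'b) hspace_scheme \<Rightarrow> ('a \<Rightarrow> 'a) \<Rightarrow> bool" where
  "self_adjoint H T \<longleftrightarrow> is_operator H T \<and>
     (\<forall>x\<in>hcarrier H. \<forall>y\<in>hcarrier H. hinner H (T x) y = hinner H x (T y))"

text \<open>Successive approximations, starting from zero, to a solution of
  \<open>Y = (B + Y\<^sup>2) / 2\<close>, that is, of
  \<open>(1 - Y)\<^sup>2 = 1 - B\<close>.\<close>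

primrec sqrt_iter :: "('a, 'b) hspace_scheme \<Rightarrow> ('a \<Rightarrow> 'a) \<Rightarrow> nat \<Rightarrow> 'a \<Rightarrow> 'a" where
  "sqrt_iter H B 0 x = hzero H"
| "sqrt_iter H B (Suc n) x = hscale H (1/2) (hadd H (B x) (sqrt_iter H B n (sqrt_iter H B n x)))"

text \<open>The scalar iteration for \<open>B = 1\<close>: its increments bound those of the operator iteration.\<close>

primrec sqrt_bound :: "nat \<Rightarrow> real" where
  "sqrt_bound 0 = 0"
| "sqrt_bound (Suc n) = (1 + (sqrt_bound n)\<^sup>2) / 2"

lemma sqrt_bound_bounds: "0 \<le> sqrt_bound n \<and> sqrt_bound n \<le> 1"
  by (induction n) (auto simp: power_le_one)

lemma incseq_sqrt_bound: "incseq sqrt_bound"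
proof (rule incseq_SucI)
  fix n
  have "0 \<le> (1 - sqrt_bound n)\<^sup>2" by simp
  then show "sqrt_bound n \<le> sqrt_bound (Suc n)" by (simp add: power2_eq_square algebra_simps)
qed

context hilbert
begin

lemma self_adjointD:
  assumes "self_adjoint H T"
  shows "is_bop H H T"
    and "x \<in> hcarrier H \<Longrightarrow> T x \<in> hcarrier H"
    and "x \<in> hcarrier H \<Longrightarrow> y \<in> hcarrier H \<Longrightarrow> hinner H (T x) y = hinner H x (T y)"
  using assms by (simp_all add: self_adjoint_def is_operator_def is_bop_def)

lemma is_bop_inner_bound:
  assumes "\<And>x. x \<in> hcarrier H \<Longrightarrow> T x \<in> hcarrier H"
    and "\<And>x y. x \<in> hcarrier H \<Longrightarrow> y \<in> hcarrier H \<Longrightarrow> cmod (hinner H (T x) y) \<le> c * hnorm H x * hnorm H y"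
    and "c \<ge> 0" and x: "x \<in> hcarrier H"
  shows "hnorm H (T x) \<le> c * hnorm H x"
  using assms by (intro norm_le_if_inner_le) auto

context
  fixes B
  assumes B: "self_adjoint H B" and B_le: "\<forall>x\<in>hcarrier H. hnorm H (B x) \<le> hnorm H x"
begin

text \<open>Closure, symmetry and the bound share one induction with \<open>x\<close> and
  \<open>y\<close> generalised, because the recursion applies the previous iterate to its own
  value.\<close>

lemma sqrt_iter_bop:
  "(x \<in> hcarrier H \<longrightarrow> sqrt_iter H B n x \<in> hcarrier H) \<and>
   (x \<in> hcarrier H \<longrightarrow> y \<in> hcarrier H \<longrightarrow>
      hinner H (sqrt_iter H B n x) y = hinner H x (sqrt_iter H B n y)) \<and>
   (x \<in> hcarrier H \<longrightarrow> hnorm H (sqrt_iter H B n x) \<le> sqrt_bound n * hnorm H x)"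
proof (induction n arbitrary: x y)
  case (Suc n)
  note [simp] = self_adjointD[OF B]
  have closed [simp]: "sqrt_iter H B n x \<in> hcarrier H" if "x \<in> hcarrier H" for x
    using Suc that by blast
  have sa: "hinner H (sqrt_iter H B n x) y = hinner H x (sqrt_iter H B n y)"
    if "x \<in> hcarrier H" "y \<in> hcarrier H" for x y
    using Suc that by blast
  have bound: "hnorm H (sqrt_iter H B n x) \<le> sqrt_bound n * hnorm H x" if "x \<in> hcarrier H" for x
    using Suc that by blast
  have "hnorm H (sqrt_iter H B (Suc n) x) \<le> sqrt_bound (Suc n) * hnorm H x" if x: "x \<in> hcarrier H"
  proof -
    let ?y = "sqrt_iter H B n (sqrt_iter H B n x)"
    have "hnorm H ?y \<le> sqrt_bound n * hnorm H (sqrt_iter H B n x)"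
      using x by (intro bound) auto
    also have "\<dots> \<le> sqrt_bound n * (sqrt_bound n * hnorm H x)"
      using x sqrt_bound_bounds by (intro mult_left_mono bound) auto
    finally have "hnorm H (hadd H (B x) ?y) \<le> hnorm H x + (sqrt_bound n)\<^sup>2 * hnorm H x"
      using x norm_triangle[of "B x" ?y] bspec[OF B_le x] by (simp add: power2_eq_square)
    then show ?thesis using x by (simp add: algebra_simps)
  qed
  then show ?case by (simp add: sa)
qed auto

lemma sqrt_iter_closed [simp]: "x \<in> hcarrier H \<Longrightarrow> sqrt_iter H B n x \<in> hcarrier H"
  and sqrt_iter_self_adjoint: "x \<in> hcarrier H \<Longrightarrow> y \<in> hcarrier H \<Longrightarrow>
      hinner H (sqrt_iter H B n x) y = hinner H x (sqrt_iter H B n y)"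
  and sqrt_iter_le: "x \<in> hcarrier H \<Longrightarrow> hnorm H (sqrt_iter H B n x) \<le> sqrt_bound n * hnorm H x"
  using sqrt_iter_bop by blast+

text \<open>Additivity and homogeneity follow from symmetry, by moving the iterate to the test
  vector and back.\<close>

lemma is_bop_sqrt_iter: "is_bop H H (sqrt_iter H B n)"
proof -
  have "sqrt_iter H B n (hadd H x y) = hadd H (sqrt_iter H B n x) (sqrt_iter H B n y)"
    if "x \<in> hcarrier H" "y \<in> hcarrier H" for x y
    using that by (intro inner_ext) (simp_all add: sqrt_iter_self_adjoint)
  moreover have "sqrt_iter H B n (hscale H a x) = hscale H a (sqrt_iter H B n x)"
    if "x \<in> hcarrier H" for a x
    using that by (intro inner_ext) (simp_all add: sqrt_iter_self_adjoint)
  ultimately show ?thesis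
    using sqrt_iter_le unfolding is_bop_def by (auto intro!: exI[of _ "sqrt_bound n"])
qed

text \<open>Each iterate is a polynomial in \<open>B\<close>.\<close>

lemma sqrt_iter_commute:
  assumes C: "is_bop H H C" "\<And>x. x \<in> hcarrier H \<Longrightarrow> C (B x) = B (C x)" and x: "x \<in> hcarrier H"
  shows "C (sqrt_iter H B n x) = sqrt_iter H B n (C x)"
  using x
proof (induction n arbitrary: x)
  case 0
  \<comment> \<open>\<open>is_bop\<close> does not mention the zero vector; homogeneity with scalar
    \<open>0\<close> shows that \<open>C\<close> fixes it.\<close>
  have "C (hscale H 0 (hzero H)) = hscale H 0 (C (hzero H))"
    by (intro is_bop_scale[OF C(1)]) auto
  moreover have "hscale H 0 y = hzero H" if "y \<in> hcarrier H" for y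
    using that by (intro inner_ext) auto
  ultimately show ?case using is_bop_closed[OF C(1)] by simp
next
  case (Suc n)
  then show ?case
    using C self_adjointD(2)[OF B] is_bop_closed[OF C(1)] by (simp add: is_bop_add[OF C(1)] is_bop_scale[OF C(1)])
qed

lemma sqrt_iter_commute_iter:
  assumes "x \<in> hcarrier H"
  shows "sqrt_iter H B m (sqrt_iter H B n x) = sqrt_iter H B n (sqrt_iter H B m x)"
  using assms is_bop_sqrt_iter self_adjointD(1)[OF B]
  by (intro sqrt_iter_commute) (auto intro: sqrt_iter_commute[symmetric])

text \<open>Iterates commute, so \<open>Y\<^sup>2 - Z\<^sup>2 = (Y - Z) (Y + Z)\<close> for any two
  of them. The scalar recursion factors in the same way, so its increments majorise those of the
  operators.\<close>

lemma sqrt_iter_diff_le: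
  assumes "n \<le> m" "x \<in> hcarrier H"
  shows "hnorm H (hdiff H (sqrt_iter H B m x) (sqrt_iter H B n x))
    \<le> (sqrt_bound m - sqrt_bound n) * hnorm H x"
  using assms
proof (induction n arbitrary: m x)
  case 0
  then have "hdiff H (sqrt_iter H B m x) (hzero H) = sqrt_iter H B m x"
    by (intro inner_ext) auto
  then show ?case using sqrt_iter_le[of x m] 0 by simp
next
  case (Suc n)
  then obtain k where k: "m = Suc k" "n \<le> k" by (cases m) auto
  have x: "x \<in> hcarrier H" by fact
  let ?a = "sqrt_bound k" and ?b = "sqrt_bound n"
  let ?Y = "sqrt_iter H B k" and ?Z = "sqrt_iter H B n"
  \<comment> \<open>The factor \<open>Y + Z\<close> is absorbed into the vector: the induction
    hypothesis is applied at \<open>w\<close> in place of \<open>x\<close>.\<close>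
  define w where "w = hadd H (?Y x) (?Z x)"
  have w: "w \<in> hcarrier H" using x by (simp add: w_def)
  have wle: "hnorm H w \<le> (?a + ?b) * hnorm H x"
    using norm_triangle[of "?Y x" "?Z x"] sqrt_iter_le[OF x, of k] sqrt_iter_le[OF x, of n] x
    by (simp add: w_def algebra_simps)
  have ab: "?b \<le> ?a" using incseq_sqrt_bound k by (simp add: incseq_def)
  have "hdiff H (sqrt_iter H B m x) (sqrt_iter H B (Suc n) x) = hscale H (1/2) (hdiff H (?Y w) (?Z w))"
    using x self_adjointD(2)[OF B] sqrt_iter_commute_iter[OF x, of n k]
    by (intro inner_ext)
      (simp_all add: k w_def is_bop_add[OF is_bop_sqrt_iter] algebra_simps)
  then have "hnorm H (hdiff H (sqrt_iter H B m x) (sqrt_iter H B (Suc n) x))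
      = hnorm H (hdiff H (?Y w) (?Z w)) / 2"
    using w by simp
  also have "\<dots> \<le> (?a - ?b) * hnorm H w / 2"
    using Suc.IH[OF k(2) w] by simp
  also have "\<dots> \<le> (?a - ?b) * ((?a + ?b) * hnorm H x) / 2"
    using wle ab by (intro divide_right_mono mult_left_mono) auto
  also have "\<dots> = (sqrt_bound m - sqrt_bound (Suc n)) * hnorm H x"
    by (simp add: k power2_eq_square field_simps)
  finally show ?case .
qed

text \<open>The scalar sequence increases and is bounded by \<open>1\<close>, hence is Cauchy, and
  its increments control the iterates at each fixed vector.\<close>

lemma sqrt_iter_limit:
  assumes x: "x \<in> hcarrier H"
  shows "\<exists>l\<in>hcarrier H. (\<lambda>n. hnorm H (hdiff H (sqrt_iter H B n x) l)) \<longlonglongrightarrow> 0"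
proof -
  have "Cauchy sqrt_bound"
    using incseq_convergent[OF incseq_sqrt_bound, of 1] sqrt_bound_bounds
    by (metis LIMSEQ_imp_Cauchy)
  have "\<exists>N. \<forall>m\<ge>N. \<forall>n\<ge>N. hnorm H (hdiff H (sqrt_iter H B m x) (sqrt_iter H B n x)) < e"
    if e: "e > 0" for e
  proof -
    \<comment> \<open>The summand \<open>1\<close> keeps the denominator positive when
      \<open>x\<close> has norm zero.\<close>
    define d where "d = e / (hnorm H x + 1)"
    have pos: "hnorm H x + 1 > 0" using norm_ge_0[OF x] by linarith
    then have d: "d > 0" using e by (simp add: d_def)
    obtain N where N: "\<And>m n. m \<ge> N \<Longrightarrow> n \<ge> N \<Longrightarrow> \<bar>sqrt_bound m - sqrt_bound n\<bar> < d"
      using \<open>Cauchy sqrt_bound\<close> d unfolding Cauchy_def dist_real_def by blast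
    have *: "hnorm H (hdiff H (sqrt_iter H B m x) (sqrt_iter H B n x)) < e"
      if "m \<ge> n" "n \<ge> N" for m n
    proof -
      have "hnorm H (hdiff H (sqrt_iter H B m x) (sqrt_iter H B n x))
        \<le> (sqrt_bound m - sqrt_bound n) * hnorm H x"
        using that x by (intro sqrt_iter_diff_le)
      also have "\<dots> \<le> d * hnorm H x"
        using N[of m n] that x by (intro mult_right_mono) auto
      also have "\<dots> < d * (hnorm H x + 1)" using d by simp
      also have "\<dots> = e" using pos by (simp add: d_def)
      finally show ?thesis .
    qed
    have sym: "hnorm H (hdiff H u v) = hnorm H (hdiff H v u)"
      if "u \<in> hcarrier H" "v \<in> hcarrier H" for u v
    proof -
      have "hdiff H u v = hscale H (-1) (hdiff H v u)"
        using that by (intro inner_ext) auto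
      then show ?thesis using that by simp
    qed
    show ?thesis
      using * sym x by (metis linorder_le_cases sqrt_iter_closed)
  qed
  from complete[OF sqrt_iter_closed[OF x] this] show ?thesis by blast
qed

text \<open>With \<open>Y\<close> the pointwise limit of the iterates and \<open>R = 1 - Y\<close>,
  the fixed point equation for \<open>Y\<close> becomes \<open>R\<^sup>2 = 1 - B\<close>. The
  commutation clause is what later makes \<open>G\<close> commute with \<open>A\<close>.\<close>

theorem sqrt_one_minus:
  "\<exists>R. self_adjoint H R \<and> (\<forall>x\<in>hcarrier H. R (R x) = hdiff H x (B x)) \<and>
    (\<forall>C. is_bop H H C \<longrightarrow> (\<forall>x\<in>hcarrier H. C (B x) = B (C x)) \<longrightarrow>
      (\<forall>x\<in>hcarrier H. C (R x) = R (C x)))"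
proof -
  interpret P: hilbert_pair H H ..
  obtain Y where Y [simp]: "x \<in> hcarrier H \<Longrightarrow> Y x \<in> hcarrier H"
    and lim: "x \<in> hcarrier H \<Longrightarrow> (\<lambda>n. hnorm H (hdiff H (sqrt_iter H B n x) (Y x))) \<longlonglongrightarrow> 0" for x
    using sqrt_iter_limit by metis
  have weak: "(\<lambda>n. hinner H (sqrt_iter H B n x) z) \<longlonglongrightarrow> hinner H (Y x) z"
    if "x \<in> hcarrier H" "z \<in> hcarrier H" for x z
    using that lim by (intro tendsto_inner_left) auto
  have sa: "hinner H (Y x) z = hinner H x (Y z)" if x: "x \<in> hcarrier H" and z: "z \<in> hcarrier H" for x z
  proof (rule LIMSEQ_unique[OF weak[OF x z]])
    have "(\<lambda>n. cnj (hinner H (sqrt_iter H B n z) x)) \<longlonglongrightarrow> cnj (hinner H (Y z) x)"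
      using x z by (intro tendsto_cnj weak)
    moreover have "cnj (hinner H (sqrt_iter H B n z) x) = hinner H (sqrt_iter H B n x) z" for n
      using x z by (simp add: sqrt_iter_self_adjoint flip: inner_commute)
    ultimately show "(\<lambda>n. hinner H (sqrt_iter H B n x) z) \<longlonglongrightarrow> hinner H x (Y z)"
      using x z by (simp flip: inner_commute)
  qed
  have bound: "hnorm H (Y x) \<le> 1 * hnorm H x" if x: "x \<in> hcarrier H" for x
  proof (rule is_bop_inner_bound)
    fix x z assume x: "x \<in> hcarrier H" and z: "z \<in> hcarrier H"
    have "cmod (hinner H (sqrt_iter H B n x) z) \<le> 1 * hnorm H x * hnorm H z" for n
    proof -
      have "cmod (hinner H (sqrt_iter H B n x) z) \<le> hnorm H (sqrt_iter H B n x) * hnorm H z"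
        using x z by (intro cauchy_schwarz) auto
      also have "\<dots> \<le> (sqrt_bound n * hnorm H x) * hnorm H z"
        using x z by (intro mult_right_mono sqrt_iter_le) auto
      also have "\<dots> \<le> (1 * hnorm H x) * hnorm H z"
        using x z sqrt_bound_bounds[of n] by (intro mult_right_mono) auto
      finally show ?thesis .
    qed
    with tendsto_norm[OF weak[OF x z]] show "cmod (hinner H (Y x) z) \<le> 1 * hnorm H x * hnorm H z"
      by (intro LIMSEQ_le_const2) auto
  qed (use x in auto)
  \<comment> \<open>The fixed point equation in weak form. Symmetry splits the square into
    \<open>hinner H (Y x) (Y z)\<close>, so the limit of a composition of iterates is never
    taken.\<close>
  have eq: "2 * hinner H (Y x) z = hinner H (B x) z + hinner H (Y x) (Y z)"
    if x: "x \<in> hcarrier H" and z: "z \<in> hcarrier H" for x z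
  proof (rule LIMSEQ_unique)
    show "(\<lambda>n. 2 * hinner H (sqrt_iter H B (Suc n) x) z) \<longlonglongrightarrow> 2 * hinner H (Y x) z"
      using LIMSEQ_Suc[OF weak[OF x z]] by (intro tendsto_intros)
    have "(\<lambda>n. hinner H (sqrt_iter H B n x) (sqrt_iter H B n z)) \<longlonglongrightarrow> hinner H (Y x) (Y z)"
      using x z lim by (intro tendsto_inner) auto
    then have "(\<lambda>n. hinner H (B x) z + hinner H (sqrt_iter H B n x) (sqrt_iter H B n z))
        \<longlonglongrightarrow> hinner H (B x) z + hinner H (Y x) (Y z)"
      by (intro tendsto_intros)
    then show "(\<lambda>n. 2 * hinner H (sqrt_iter H B (Suc n) x) z)
        \<longlonglongrightarrow> hinner H (B x) z + hinner H (Y x) (Y z)"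
      using x z self_adjointD(2)[OF B] by (simp add: sqrt_iter_self_adjoint add_divide_distrib)
  qed
  \<comment> \<open>The adjoint of \<open>C\<close> acts on the test vector, so weak convergence of
    the iterates is enough.\<close>
  have commute: "C (Y x) = Y (C x)"
    if C: "is_bop H H C" "\<And>x. x \<in> hcarrier H \<Longrightarrow> C (B x) = B (C x)" and x: "x \<in> hcarrier H" for C x
  proof (rule inner_ext)
    note [simp] = is_bop_closed[OF C(1)] is_bop_closed[OF P.is_bop_hadj[OF C(1)]]
    fix z assume z: "z \<in> hcarrier H"
    have "hinner H (sqrt_iter H B n (C x)) z = hinner H (sqrt_iter H B n x) (hadj H H C z)" for n
      using x z sqrt_iter_commute[OF C x, of n] by (simp add: P.inner_hadj_right[OF C(1)])
    moreover have "(\<lambda>n. hinner H (sqrt_iter H B n x) (hadj H H C z)) \<longlonglongrightarrow> hinner H (Y x) (hadj H H C z)"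
      using x z by (intro weak) auto
    ultimately have "(\<lambda>n. hinner H (sqrt_iter H B n (C x)) z) \<longlonglongrightarrow> hinner H (C (Y x)) z"
      using x z by (simp add: P.inner_hadj_right[OF C(1)])
    moreover have "(\<lambda>n. hinner H (sqrt_iter H B n (C x)) z) \<longlonglongrightarrow> hinner H (Y (C x)) z"
      using x z by (intro weak) auto
    ultimately show "hinner H (C (Y x)) z = hinner H (Y (C x)) z"
      by (rule LIMSEQ_unique)
  qed (use x is_bop_closed[OF C(1)] in auto)
  define R where "R x = hdiff H x (Y x)" for x
  have R [simp]: "R x \<in> hcarrier H" if "x \<in> hcarrier H" for x
    using that by (simp add: R_def)
  have R_sa: "hinner H (R x) y = hinner H x (R y)" if "x \<in> hcarrier H" "y \<in> hcarrier H" for x y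
    using that by (simp add: R_def sa)
  have R_bound: "hnorm H (R x) \<le> 2 * hnorm H x" if x: "x \<in> hcarrier H" for x
    using norm_triangle[of x "hscale H (-1) (Y x)"] bound[OF x] x by (simp add: R_def hdiff_def)
  have R_add: "R (hadd H x y) = hadd H (R x) (R y)" if "x \<in> hcarrier H" "y \<in> hcarrier H" for x y
    using that by (intro inner_ext) (simp_all add: R_sa)
  have R_scale: "R (hscale H a x) = hscale H a (R x)" if "x \<in> hcarrier H" for a x
    using that by (intro inner_ext) (simp_all add: R_sa)
  have "is_bop H H R"
    using R_bound R_add R_scale by (auto simp: is_bop_def)
  then have "self_adjoint H R" by (simp add: self_adjoint_def is_operator_def R_sa)
  moreover have "R (R x) = hdiff H x (B x)" if x: "x \<in> hcarrier H" for x
  proof (rule inner_ext)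
    fix z assume z: "z \<in> hcarrier H"
    have "hinner H (R (R x)) z = hinner H (R x) (R z)"
      using x z by (intro R_sa) auto
    also have "\<dots> = hinner H (hdiff H x (Y x)) (hdiff H z (Y z))"
      by (simp only: R_def)
    also have "\<dots> = hinner H (hdiff H x (B x)) z"
      using x z eq[OF x z] self_adjointD(2)[OF B] sa[OF x z] by (simp add: algebra_simps)
    finally show "hinner H (R (R x)) z = hinner H (hdiff H x (B x)) z" .
  qed (use x self_adjointD(2)[OF B] in auto)
  moreover have "C (R x) = R (C x)"
    if "is_bop H H C" "\<And>x. x \<in> hcarrier H \<Longrightarrow> C (B x) = B (C x)" "x \<in> hcarrier H" for C x
    using that commute[OF that] is_bop_diff[OF hilbert_axioms that(1)] by (simp add: R_def)
  ultimately show ?thesis by (intro exI[of _ R] conjI ballI allI impI) auto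
qed

end

end

section \<open>Linear combinations and orthogonal projections\<close>

context hilbert_pair
begin

lemma is_bop_zero: "is_bop H K (\<lambda>x. hzero K)"
proof -
  have "hadd K (hzero K) (hzero K) = hzero K" "hscale K a (hzero K) = hzero K" for a
    by (rule K.inner_ext; simp)+
  then show ?thesis by (simp add: is_bop_def exI[of _ 0])
qed

lemma is_bop_scaled:
  assumes T: "is_bop H K T"
  shows "is_bop H K (\<lambda>x. hscale K a (T x))"
proof -
  note closed = is_bop_closed[OF T]
  obtain C where C: "C \<ge> 0" "\<And>x. x \<in> hcarrier H \<Longrightarrow> hnorm K (T x) \<le> C * hnorm H x"
    using is_bop_bounded[OF H.hilbert_axioms T] by blast
  have "hnorm K (hscale K a (T x)) \<le> (cmod a * C) * hnorm H x" if "x \<in> hcarrier H" for x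
    using mult_left_mono[OF C(2)[OF that], of "cmod a"] that closed by (simp add: mult.assoc)
  then have "\<exists>C. \<forall>x\<in>hcarrier H. hnorm K (hscale K a (T x)) \<le> C * hnorm H x" by blast
  moreover have "hscale K a (T (hadd H x y)) = hadd K (hscale K a (T x)) (hscale K a (T y))"
    if "x \<in> hcarrier H" "y \<in> hcarrier H" for x y
    by (rule K.inner_ext) (use that in \<open>simp_all add: closed is_bop_add[OF T] algebra_simps\<close>)
  moreover have "hscale K a (T (hscale H b x)) = hscale K b (hscale K a (T x))"
    if "x \<in> hcarrier H" for b x
    by (rule K.inner_ext) (use that in \<open>simp_all add: closed is_bop_scale[OF T]\<close>)
  ultimately show ?thesis by (simp add: is_bop_def closed)
qed

lemma is_bop_plus:
  assumes S: "is_bop H K S" and T: "is_bop H K T"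
  shows "is_bop H K (\<lambda>x. hadd K (S x) (T x))"
proof -
  note closed = is_bop_closed[OF S] is_bop_closed[OF T]
  obtain C where C: "\<And>x. x \<in> hcarrier H \<Longrightarrow> hnorm K (S x) \<le> C * hnorm H x"
    using is_bop_bounded[OF H.hilbert_axioms S] by blast
  obtain D where D: "\<And>x. x \<in> hcarrier H \<Longrightarrow> hnorm K (T x) \<le> D * hnorm H x"
    using is_bop_bounded[OF H.hilbert_axioms T] by blast
  have "hnorm K (hadd K (S x) (T x)) \<le> (C + D) * hnorm H x" if "x \<in> hcarrier H" for x
    using K.norm_triangle[of "S x" "T x"] C[OF that] D[OF that] that closed by (simp add: algebra_simps)
  then have "\<exists>C. \<forall>x\<in>hcarrier H. hnorm K (hadd K (S x) (T x)) \<le> C * hnorm H x" by blast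
  moreover have "hadd K (S (hadd H x y)) (T (hadd H x y))
      = hadd K (hadd K (S x) (T x)) (hadd K (S y) (T y))"
    if "x \<in> hcarrier H" "y \<in> hcarrier H" for x y
    by (rule K.inner_ext)
      (use that in \<open>simp_all add: closed is_bop_add[OF S] is_bop_add[OF T] algebra_simps\<close>)
  moreover have "hadd K (S (hscale H b x)) (T (hscale H b x)) = hscale K b (hadd K (S x) (T x))"
    if "x \<in> hcarrier H" for b x
    by (rule K.inner_ext)
      (use that in \<open>simp_all add: closed is_bop_scale[OF S] is_bop_scale[OF T] algebra_simps\<close>)
  ultimately show ?thesis by (simp add: is_bop_def closed)
qed

end

context hilbert
begin

lemma is_bop_id: "is_bop H H (\<lambda>x. x)"
  by (auto simp: is_bop_def intro: exI[of _ 1])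

lemma self_adjoint_id: "self_adjoint H (\<lambda>x. x)"
  by (simp add: self_adjoint_def is_operator_def is_bop_id)

lemma self_adjoint_lincomb:
  assumes S: "self_adjoint H S" and T: "self_adjoint H T"
  shows "self_adjoint H (\<lambda>x. hadd H (hscale H (complex_of_real a) (S x)) (hscale H (complex_of_real b) (T x)))"
proof -
  interpret P: hilbert_pair H H ..
  show ?thesis
    using self_adjointD[OF S] self_adjointD[OF T]
    by (simp add: self_adjoint_def is_operator_def P.is_bop_plus P.is_bop_scaled)
qed

lemma is_orth_projI:
  assumes P: "self_adjoint H P" and "\<And>x. x \<in> hcarrier H \<Longrightarrow> P (P x) = P x"
  shows "is_orth_proj H P"
proof -
  interpret P: hilbert_pair H H ..
  have "hadj H H P x = P x" if "x \<in> hcarrier H" for x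
    by (rule P.hadj_eqI) (use self_adjointD[OF P] that in auto)
  then show ?thesis
    using assms by (simp add: is_orth_proj_def self_adjoint_def)
qed

lemma orth_proj_inner:
  assumes P: "is_orth_proj H P" and x: "x \<in> hcarrier H"
  shows "hinner H (P x) x = of_real ((hnorm H (P x))\<^sup>2)"
proof -
  interpret P: hilbert_pair H H ..
  have bop: "is_bop H H P" using P by (simp add: is_orth_proj_def is_operator_def)
  have Px: "P x \<in> hcarrier H" using is_bop_closed[OF bop x] .
  have "hinner H (P x) x = hinner H (P (P x)) x" using P x by (simp add: is_orth_proj_def)
  also have "\<dots> = hinner H (P x) (hadj H H P x)" using P.inner_hadj_right[OF bop Px x] by simp
  also have "\<dots> = hinner H (P x) (P x)" using P x by (simp add: is_orth_proj_def)
  finally show ?thesis using inner_self[OF Px] by simp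
qed

text \<open>\<open>quad\<close> says \<open>(L - 1) (L - c) = 0\<close>. Lagrange interpolation at
  the two roots gives \<open>P0 = (L - c) / (1 - c)\<close> and
  \<open>P1 = (1 - L) / (1 - c)\<close>.\<close>

lemma quadratic_spectral_decomposition:
  assumes L: "self_adjoint H L" and "c \<noteq> 1"
    and quad: "\<And>x. x \<in> hcarrier H \<Longrightarrow> L (L x) =
      hdiff H (hscale H (complex_of_real (1 + c)) (L x)) (hscale H (complex_of_real c) x)"
  shows "\<exists>P0 P1. is_orth_proj H P0 \<and> is_orth_proj H P1 \<and>
        (\<forall>x\<in>hcarrier H. hadd H (P0 x) (P1 x) = x) \<and>
        (\<forall>x\<in>hcarrier H. L x = hadd H (P0 x) (hscale H (complex_of_real c) (P1 x)))"
proof -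
  note [simp] = self_adjointD(2)[OF L]
  define d where "d = 1 / (1 - c)"
  have d: "d * (1 - c) = 1" using \<open>c \<noteq> 1\<close> by (simp add: d_def)
  \<comment> \<open>Each identity below is factored so that \<open>d * (1 - c)\<close> appears and
    can be replaced by \<open>1\<close>.\<close>
  have d': "complex_of_real d * (1 - complex_of_real c) = 1"
    using arg_cong[OF d, of complex_of_real] by simp
  define P0 where "P0 = (\<lambda>x. hadd H (hscale H (complex_of_real d) (L x)) (hscale H (complex_of_real (- c * d)) x))"
  define P1 where "P1 = (\<lambda>x. hadd H (hscale H (complex_of_real (- d)) (L x)) (hscale H (complex_of_real d) x))"
  note Ladd = is_bop_add[OF self_adjointD(1)[OF L]] and Lscale = is_bop_scale[OF self_adjointD(1)[OF L]]
  have sa: "self_adjoint H P0" "self_adjoint H P1"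
    unfolding P0_def P1_def by (rule self_adjoint_lincomb[OF L self_adjoint_id])+
  have [simp]: "P0 x \<in> hcarrier H" "P1 x \<in> hcarrier H" if "x \<in> hcarrier H" for x
    using sa[THEN self_adjointD(2)] that by auto
  have idem0: "P0 (P0 x) = P0 x" if x: "x \<in> hcarrier H" for x
  proof (rule inner_ext)
    fix z assume z: "z \<in> hcarrier H"
    let ?a = "hinner H (L x) z" and ?b = "hinner H x z"
    let ?d = "complex_of_real d" and ?c = "complex_of_real c"
    have "hinner H (P0 (P0 x)) z = (?d * (1 - ?c)) * (?d * ?a - ?c * ?d * ?b)"
      using x z by (simp add: P0_def Ladd Lscale quad algebra_simps)
    then show "hinner H (P0 (P0 x)) z = hinner H (P0 x) z"
      using x z by (simp add: d' P0_def)
  qed (use x in auto)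
  have idem1: "P1 (P1 x) = P1 x" if x: "x \<in> hcarrier H" for x
  proof (rule inner_ext)
    fix z assume z: "z \<in> hcarrier H"
    let ?a = "hinner H (L x) z" and ?b = "hinner H x z"
    let ?d = "complex_of_real d" and ?c = "complex_of_real c"
    have "hinner H (P1 (P1 x)) z = (?d * (1 - ?c)) * (?d * ?b - ?d * ?a)"
      using x z by (simp add: P1_def Ladd Lscale quad algebra_simps)
    then show "hinner H (P1 (P1 x)) z = hinner H (P1 x) z"
      using x z by (simp add: d' P1_def)
  qed (use x in auto)
  have sum: "hadd H (P0 x) (P1 x) = x" if x: "x \<in> hcarrier H" for x
  proof (rule inner_ext)
    fix z assume z: "z \<in> hcarrier H"
    have "hinner H (hadd H (P0 x) (P1 x)) z = (complex_of_real d * (1 - complex_of_real c)) * hinner H x z"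
      using x z by (simp add: P0_def P1_def algebra_simps)
    then show "hinner H (hadd H (P0 x) (P1 x)) z = hinner H x z" by (simp add: d')
  qed (use x in auto)
  have L_eq: "L x = hadd H (P0 x) (hscale H (complex_of_real c) (P1 x))" if x: "x \<in> hcarrier H" for x
  proof (rule inner_ext)
    fix z assume z: "z \<in> hcarrier H"
    have "hinner H (hadd H (P0 x) (hscale H (complex_of_real c) (P1 x))) z
        = (complex_of_real d * (1 - complex_of_real c)) * hinner H (L x) z"
      using x z by (simp add: P0_def P1_def algebra_simps)
    then show "hinner H (L x) z = hinner H (hadd H (P0 x) (hscale H (complex_of_real c) (P1 x))) z"
      by (simp add: d')
  qed (use x in auto)
  show ?thesis
    by (intro exI[of _ P0] exI[of _ P1] conjI ballI is_orth_projI sa idem0 idem1 sum L_eq)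
qed

text \<open>Polarisation with \<open>y = S x\<close>: adding the upper bound at \<open>x + y\<close>
  to the lower bound at \<open>x - y\<close> gives four times the squared norm of \<open>y\<close>
  on one side and, by the parallelogram law, twice the sum of the squared norms of \<open>x\<close>
  and \<open>y\<close> on the other.\<close>

lemma self_adjoint_contraction:
  assumes S: "self_adjoint H S"
    and form: "\<And>x. x \<in> hcarrier H \<Longrightarrow> \<bar>Re (hinner H (S x) x)\<bar> \<le> (hnorm H x)\<^sup>2"
    and x: "x \<in> hcarrier H"
  shows "hnorm H (S x) \<le> hnorm H x"
proof (rule power2_le_imp_le)
  note [simp] = self_adjointD(2)[OF S]
  let ?y = "S x"
  have "Re (hinner H (S (hadd H x ?y)) (hadd H x ?y)) \<le> (hnorm H (hadd H x ?y))\<^sup>2"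
    "- Re (hinner H (S (hdiff H x ?y)) (hdiff H x ?y)) \<le> (hnorm H (hdiff H x ?y))\<^sup>2"
    using form[of "hadd H x ?y"] form[of "hdiff H x ?y"] x by auto
  moreover have "hinner H (S ?y) x = hinner H ?y ?y"
    using x by (simp add: self_adjointD(3)[OF S])
  ultimately show "(hnorm H ?y)\<^sup>2 \<le> (hnorm H x)\<^sup>2"
    using x by (simp add: norm_square is_bop_add[OF self_adjointD(1)[OF S]]
        is_bop_diff[OF hilbert_axioms self_adjointD(1)[OF S]])
qed (use x in auto)

end

section \<open>The direct sum of two copies of a Hilbert space\<close>

text \<open>The pair \<open>(x, y)\<close> is encoded as the function with values \<open>x\<close> at \<open>0\<close>, \<open>y\<close> at \<open>1\<close> and
  zero elsewhere.\<close>

definition hpair :: "('a, 'b) hspace_scheme \<Rightarrow> 'a \<Rightarrow> 'a \<Rightarrow> int \<Rightarrow> 'a" where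
  "hpair H x y = (\<lambda>n. if n = 0 then x else if n = 1 then y else hzero H)"

text \<open>The carrier contains only values of \<open>hpair\<close>, so each vector has a single
  representing function; the inner product sees just the arguments \<open>0\<close> and
  \<open>1\<close> and would otherwise not be definite.\<close>

definition hdouble :: "('a, 'b) hspace_scheme \<Rightarrow> (int \<Rightarrow> 'a) hspace" where
  "hdouble H = \<lparr>hcarrier = {hpair H x y | x y. x \<in> hcarrier H \<and> y \<in> hcarrier H},
     hadd = (\<lambda>f g. hpair H (hadd H (f 0) (g 0)) (hadd H (f 1) (g 1))),
     hscale = (\<lambda>a f. hpair H (hscale H a (f 0)) (hscale H a (f 1))),
     hzero = hpair H (hzero H) (hzero H),
     hinner = (\<lambda>f g. hinner H (f 0) (g 0) + hinner H (f 1) (g 1))\<rparr>"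

definition hblock :: "('a, 'b) hspace_scheme \<Rightarrow> ('a \<Rightarrow> 'a) \<Rightarrow> ('a \<Rightarrow> 'a) \<Rightarrow> ('a \<Rightarrow> 'a) \<Rightarrow> ('a \<Rightarrow> 'a)
    \<Rightarrow> (int \<Rightarrow> 'a) \<Rightarrow> (int \<Rightarrow> 'a)" where
  "hblock H P Q R S f = hpair H (hadd H (P (f 0)) (Q (f 1))) (hadd H (R (f 0)) (S (f 1)))"

lemma hpair_simps [simp]: "hpair H x y 0 = x" "hpair H x y 1 = y"
  by (simp_all add: hpair_def)

lemma hpair_eq_iff [simp]: "hpair H x y = hpair H x' y' \<longleftrightarrow> x = x' \<and> y = y'"
  by (metis hpair_simps)

lemma hdouble_simps [simp]:
  "hpair H x y \<in> hcarrier (hdouble H) \<longleftrightarrow> x \<in> hcarrier H \<and> y \<in> hcarrier H"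
  "hadd (hdouble H) f g = hpair H (hadd H (f 0) (g 0)) (hadd H (f 1) (g 1))"
  "hscale (hdouble H) a f = hpair H (hscale H a (f 0)) (hscale H a (f 1))"
  "hzero (hdouble H) = hpair H (hzero H) (hzero H)"
  "hinner (hdouble H) f g = hinner H (f 0) (g 0) + hinner H (f 1) (g 1)"
  "hdiff (hdouble H) f g = hpair H (hdiff H (f 0) (g 0)) (hdiff H (f 1) (g 1))"
  by (auto simp: hdouble_def hdiff_def)

lemma hdouble_cases:
  assumes "f \<in> hcarrier (hdouble H)"
  obtains x y where "f = hpair H x y" "x \<in> hcarrier H" "y \<in> hcarrier H"
  using assms by (auto simp: hdouble_def)

context hilbert
begin

lemma hdouble_closed [simp]:
  assumes "f \<in> hcarrier (hdouble H)"
  shows "f 0 \<in> hcarrier H" "f 1 \<in> hcarrier H"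
  using assms by (auto elim!: hdouble_cases)

lemma hnorm_hdouble:
  assumes "f \<in> hcarrier (hdouble H)"
  shows "hnorm (hdouble H) f = sqrt ((hnorm H (f 0))\<^sup>2 + (hnorm H (f 1))\<^sup>2)"
  using assms by (simp add: hnorm_def[of "hdouble H"] norm_square)

lemma hnorm_hdouble_ge:
  assumes "f \<in> hcarrier (hdouble H)"
  shows "hnorm H (f 0) \<le> hnorm (hdouble H) f" "hnorm H (f 1) \<le> hnorm (hdouble H) f"
  using assms by (auto simp: hnorm_hdouble intro!: real_le_rsqrt)

lemma hnorm_hdouble_le:
  assumes "f \<in> hcarrier (hdouble H)"
  shows "hnorm (hdouble H) f \<le> hnorm H (f 0) + hnorm H (f 1)"
  using assms by (simp add: hnorm_hdouble sqrt_sum_squares_le_sum)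

text \<open>The norm of a pair dominates both coordinate norms and is at most their sum, so the
  Cauchy property passes down to the coordinates and convergence passes back up.\<close>

lemma hdouble_complete:
  assumes f: "\<And>n. f n \<in> hcarrier (hdouble H)"
    and cauchy: "\<And>e. e > 0 \<Longrightarrow> \<exists>N. \<forall>m\<ge>N. \<forall>n\<ge>N. hnorm (hdouble H) (hdiff (hdouble H) (f m) (f n)) < e"
  shows "\<exists>l\<in>hcarrier (hdouble H). (\<lambda>n. hnorm (hdouble H) (hdiff (hdouble H) (f n) l)) \<longlonglongrightarrow> 0"
proof -
  have le: "hnorm H (hdiff H (f m i) (f n i)) \<le> hnorm (hdouble H) (hdiff (hdouble H) (f m) (f n))"
    if "i \<in> {0, 1}" for m n i
    using hnorm_hdouble_ge[of "hdiff (hdouble H) (f m) (f n)"] f that by auto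
  have "\<exists>l\<in>hcarrier H. (\<lambda>n. hnorm H (hdiff H (f n i) l)) \<longlonglongrightarrow> 0" if i: "i \<in> {0, 1}" for i
  proof -
    have fi: "f n i \<in> hcarrier H" for n using f[of n] i by auto
    have ci: "\<exists>N. \<forall>m\<ge>N. \<forall>n\<ge>N. hnorm H (hdiff H (f m i) (f n i)) < e" if "e > 0" for e
      using cauchy[OF that] le[OF i] by (meson le_less_trans)
    show ?thesis using complete[of "\<lambda>n. f n i", OF fi ci] by blast
  qed
  from this[of 0] this[of 1] obtain x y
    where xy: "x \<in> hcarrier H" "y \<in> hcarrier H"
      and lim: "(\<lambda>n. hnorm H (hdiff H (f n 0) x)) \<longlonglongrightarrow> 0" "(\<lambda>n. hnorm H (hdiff H (f n 1) y)) \<longlonglongrightarrow> 0"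
    by auto
  have "(\<lambda>n. hnorm (hdouble H) (hdiff (hdouble H) (f n) (hpair H x y))) \<longlonglongrightarrow> 0"
  proof (rule null_seq_bound)
    show "(\<lambda>n. hnorm H (hdiff H (f n 0) x) + hnorm H (hdiff H (f n 1) y)) \<longlonglongrightarrow> 0"
      using tendsto_add[OF lim] by simp
    show "norm (hnorm (hdouble H) (hdiff (hdouble H) (f n) (hpair H x y)))
      \<le> hnorm H (hdiff H (f n 0) x) + hnorm H (hdiff H (f n 1) y)" for n
      using hnorm_hdouble_le[of "hdiff (hdouble H) (f n) (hpair H x y)"]
        hnorm_hdouble[of "hdiff (hdouble H) (f n) (hpair H x y)"] f xy by simp
  qed
  with xy show ?thesis by (intro bexI[of _ "hpair H x y"]) auto
qed

lemma is_hilbert_hdouble: "is_hilbert (hdouble H)"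
proof -
  have assoc: "hadd H (hadd H x y) z = hadd H x (hadd H y z)"
    and comm: "hadd H x y = hadd H y x"
    and distrib: "hscale H a (hadd H x y) = hadd H (hscale H a x) (hscale H a y)"
    and distrib': "hscale H (a + b) x = hadd H (hscale H a x) (hscale H b x)"
    and scale_scale: "hscale H a (hscale H b x) = hscale H (a * b) x"
    if "x \<in> hcarrier H" "y \<in> hcarrier H" "z \<in> hcarrier H" for x y z a b
    by (rule inner_ext; use that in \<open>simp add: algebra_simps\<close>)+
  have neg: "hadd H x (hscale H (-1) x) = hzero H" if "x \<in> hcarrier H" for x
    by (rule inner_ext) (use that in simp_all)
  have neg': "\<exists>y\<in>hcarrier (hdouble H). hadd (hdouble H) x y = hzero (hdouble H)"
    if "x \<in> hcarrier (hdouble H)" for x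
    by (rule bexI[of _ "hscale (hdouble H) (-1) x"]) (use that neg in auto)
  have pos: "x = hzero (hdouble H)"
    if x: "x \<in> hcarrier (hdouble H)" and 0: "hinner (hdouble H) x x = 0" for x
  proof -
    from x obtain u v where uv: "x = hpair H u v" "u \<in> hcarrier H" "v \<in> hcarrier H"
      by (rule hdouble_cases)
    have "complex_of_real ((hnorm H u)\<^sup>2 + (hnorm H v)\<^sup>2) = 0"
      using 0 uv by (simp add: inner_self)
    then have "hnorm H u = 0 \<and> hnorm H v = 0"
      unfolding of_real_eq_0_iff by (simp add: sum_power2_eq_zero_iff)
    then show ?thesis using uv by (simp add: norm_eq_0_iff)
  qed
  show ?thesis
    unfolding is_hilbert_def
  proof (intro conjI)
    show "\<forall>f. (\<forall>n. f n \<in> hcarrier (hdouble H)) \<and>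
        (\<forall>e>0. \<exists>N. \<forall>m\<ge>N. \<forall>n\<ge>N. hnorm (hdouble H) (hdiff (hdouble H) (f m) (f n)) < e) \<longrightarrow>
        (\<exists>l\<in>hcarrier (hdouble H). (\<lambda>n. hnorm (hdouble H) (hdiff (hdouble H) (f n) l)) \<longlonglongrightarrow> 0)"
      using hdouble_complete by blast
    show "\<forall>x\<in>hcarrier (hdouble H). \<exists>y\<in>hcarrier (hdouble H). hadd (hdouble H) x y = hzero (hdouble H)"
      using neg' by blast
    show "\<forall>x\<in>hcarrier (hdouble H). hinner (hdouble H) x x = 0 \<longrightarrow> x = hzero (hdouble H)"
      using pos by blast
    show "\<forall>x\<in>hcarrier (hdouble H). \<forall>y\<in>hcarrier (hdouble H).
        hinner (hdouble H) y x = cnj (hinner (hdouble H) x y)"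
      by (auto elim!: hdouble_cases simp: inner_commute[symmetric])
    show "\<forall>x\<in>hcarrier (hdouble H). \<forall>y\<in>hcarrier (hdouble H).
        hadd (hdouble H) x y = hadd (hdouble H) y x"
      using comm by (auto elim!: hdouble_cases)
  qed (auto elim!: hdouble_cases simp: assoc distrib distrib' scale_scale inner_ge_0 algebra_simps)
qed

end

section \<open>The dilation\<close>

context hilbert
begin

text \<open>Each row is a sum of compositions with the bounded coordinate maps, and the bounds of
  the two rows add up.\<close>

lemma is_bop_hblock:
  assumes "is_bop H H P" "is_bop H H Q" "is_bop H H R" "is_bop H H S"
  shows "is_bop (hdouble H) (hdouble H) (hblock H P Q R S)"
proof -
  interpret D: hilbert "hdouble H" by (rule hilbert.intro[OF is_hilbert_hdouble])
  interpret HD: hilbert_pair "hdouble H" H ..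
  have proj: "is_bop (hdouble H) H (\<lambda>f. f 0)" "is_bop (hdouble H) H (\<lambda>f. f 1)"
    using hnorm_hdouble_ge by (auto simp: is_bop_def intro!: exI[of _ 1])
  note comp = is_bop_comp[OF D.hilbert_axioms hilbert_axioms]
  define a where "a f = hadd H (P (f 0)) (Q (f 1))" for f :: "int \<Rightarrow> 'a"
  define b where "b f = hadd H (R (f 0)) (S (f 1))" for f :: "int \<Rightarrow> 'a"
  have a: "is_bop (hdouble H) H a" and b: "is_bop (hdouble H) H b"
    unfolding a_def[abs_def] b_def[abs_def]
    using assms by (simp_all add: HD.is_bop_plus comp[OF proj(1)] comp[OF proj(2)])
  note closed = is_bop_closed[OF a] is_bop_closed[OF b]
  obtain A where A: "\<And>f. f \<in> hcarrier (hdouble H) \<Longrightarrow> hnorm H (a f) \<le> A * hnorm (hdouble H) f"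
    using is_bop_bounded[OF D.hilbert_axioms a] by blast
  obtain B where B: "\<And>f. f \<in> hcarrier (hdouble H) \<Longrightarrow> hnorm H (b f) \<le> B * hnorm (hdouble H) f"
    using is_bop_bounded[OF D.hilbert_axioms b] by blast
  have eq: "hblock H P Q R S f = hpair H (a f) (b f)" for f
    by (simp add: hblock_def a_def b_def)
  have "hnorm (hdouble H) (hpair H (a f) (b f)) \<le> (A + B) * hnorm (hdouble H) f"
    if "f \<in> hcarrier (hdouble H)" for f
    using hnorm_hdouble_le[of "hpair H (a f) (b f)"] closed that A[OF that] B[OF that]
    by (simp add: distrib_right)
  then have "\<exists>C. \<forall>f\<in>hcarrier (hdouble H). hnorm (hdouble H) (hpair H (a f) (b f)) \<le> C * hnorm (hdouble H) f"
    by blast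
  moreover have "a (hadd (hdouble H) f g) = hadd H (a f) (a g)"
    "b (hadd (hdouble H) f g) = hadd H (b f) (b g)"
    if "f \<in> hcarrier (hdouble H)" "g \<in> hcarrier (hdouble H)" for f g
    by (rule is_bop_add[OF a that] is_bop_add[OF b that])+
  moreover have "a (hscale (hdouble H) c f) = hscale H c (a f)"
    "b (hscale (hdouble H) c f) = hscale H c (b f)"
    if "f \<in> hcarrier (hdouble H)" for c f
    by (rule is_bop_scale[OF a that] is_bop_scale[OF b that])+
  ultimately show ?thesis
    unfolding is_bop_def eq using closed by (simp del: hdouble_simps(2,3)) simp
qed

text \<open>\<open>A = T\<^sup>* T\<close> has spectrum in \<open>[r\<^sup>2, 1]\<close>, so \<open>(1 - A) (A - r\<^sup>2) = b\<^sup>2 (1 - S\<^sup>2)\<close> for a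
  contraction \<open>S\<close> that is affine in \<open>A\<close>.\<close>

lemma defect_square_root:
  assumes A: "self_adjoint H A" and r: "0 < r" "r < 1"
    and ge: "\<forall>x\<in>hcarrier H. r\<^sup>2 * (hnorm H x)\<^sup>2 \<le> Re (hinner H (A x) x)"
    and le: "\<forall>x\<in>hcarrier H. Re (hinner H (A x) x) \<le> (hnorm H x)\<^sup>2"
  shows "\<exists>G. self_adjoint H G \<and> (\<forall>x\<in>hcarrier H. A (G x) = G (A x)) \<and>
    (\<forall>x\<in>hcarrier H. G (G x) =
      hdiff H (hdiff H (hscale H (of_real (1 + r\<^sup>2)) (A x)) (A (A x))) (hscale H (of_real (r\<^sup>2)) x))"
proof -
  \<comment> \<open>\<open>b\<close> and \<open>a\<close> are half the length and the midpoint of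
    the interval from \<open>r\<^sup>2\<close> to \<open>1\<close>, which the affine map
    \<open>S = (A - a) / b\<close> carries to the interval from \<open>-1\<close> to
    \<open>1\<close>.\<close>
  define b where "b = (1 - r\<^sup>2) / 2"
  define a where "a = (1 + r\<^sup>2) / 2"
  have "r\<^sup>2 < 1" using r by (simp add: power_less_one_iff)
  then have b: "b > 0" by (simp add: b_def)
  note A_lin = is_bop_add[OF self_adjointD(1)[OF A]] is_bop_scale[OF self_adjointD(1)[OF A]]
    is_bop_diff[OF hilbert_axioms self_adjointD(1)[OF A]]
  note [simp] = self_adjointD(2)[OF A]
  define S where "S = (\<lambda>x. hadd H (hscale H (of_real (1 / b)) (A x)) (hscale H (of_real (- a / b)) x))"
  have S: "self_adjoint H S"
    unfolding S_def by (rule self_adjoint_lincomb[OF A self_adjoint_id])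
  note S_lin = is_bop_add[OF self_adjointD(1)[OF S]] is_bop_scale[OF self_adjointD(1)[OF S]]
  note [simp] = self_adjointD(2)[OF S]
  have S_le: "hnorm H (S x) \<le> hnorm H x" if "x \<in> hcarrier H" for x
  proof (rule self_adjoint_contraction[OF S _ that])
    fix x assume x: "x \<in> hcarrier H"
    have "Re (hinner H (S x) x) = (Re (hinner H (A x) x) - a * (hnorm H x)\<^sup>2) / b"
      using x by (simp add: S_def norm_square diff_divide_distrib)
    moreover have "\<bar>Re (hinner H (A x) x) - a * (hnorm H x)\<^sup>2\<bar> \<le> b * (hnorm H x)\<^sup>2"
      using bspec[OF ge x] bspec[OF le x] by (simp add: a_def b_def field_simps abs_le_iff)
    ultimately show "\<bar>Re (hinner H (S x) x)\<bar> \<le> (hnorm H x)\<^sup>2"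
      using b by (simp add: abs_divide pos_divide_le_eq mult.commute)
  qed
  define B where "B = (\<lambda>x. S (S x))"
  have B: "self_adjoint H B"
    using is_bop_comp[OF hilbert_axioms hilbert_axioms self_adjointD(1)[OF S] self_adjointD(1)[OF S]]
    by (simp add: B_def self_adjoint_def is_operator_def self_adjointD(3)[OF S])
  have "\<forall>x\<in>hcarrier H. hnorm H (B x) \<le> hnorm H x"
    unfolding B_def by (auto intro: order_trans[OF S_le S_le])
  from sqrt_one_minus[OF B this] obtain R where R: "self_adjoint H R"
    and RR: "\<forall>x\<in>hcarrier H. R (R x) = hdiff H x (B x)"
    and comm: "\<forall>C. is_bop H H C \<longrightarrow> (\<forall>x\<in>hcarrier H. C (B x) = B (C x)) \<longrightarrow>
      (\<forall>x\<in>hcarrier H. C (R x) = R (C x))"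
    by (elim exE conjE)
  note [simp] = self_adjointD(2)[OF R]
  have AS: "A (S x) = S (A x)" if "x \<in> hcarrier H" for x
    using that by (simp add: S_def A_lin)
  have AR: "A (R x) = R (A x)" if "x \<in> hcarrier H" for x
    using comm[rule_format, OF self_adjointD(1)[OF A]] that by (simp add: B_def AS)
  \<comment> \<open>The summand with coefficient \<open>0\<close> only gives \<open>G\<close> the
    shape required by \<open>self_adjoint_lincomb\<close>.\<close>
  define G where "G = (\<lambda>x. hadd H (hscale H (of_real b) (R x)) (hscale H (of_real 0) x))"
  have G: "self_adjoint H G"
    unfolding G_def by (rule self_adjoint_lincomb[OF R self_adjoint_id])
  have G_eq: "G x = hscale H (of_real b) (R x)" if "x \<in> hcarrier H" for x
    by (rule inner_ext) (use that in \<open>simp_all add: G_def\<close>)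
  have "A (G x) = G (A x)" if "x \<in> hcarrier H" for x
    using that by (simp add: G_eq A_lin AR)
  moreover have "G (G x) =
      hdiff H (hdiff H (hscale H (of_real (1 + r\<^sup>2)) (A x)) (A (A x))) (hscale H (of_real (r\<^sup>2)) x)"
    if x: "x \<in> hcarrier H" for x
  proof (rule inner_ext)
    fix z assume z: "z \<in> hcarrier H"
    let ?b = "complex_of_real b" and ?a = "complex_of_real a"
    have SS: "?b * ?b * hinner H (S (S x)) z = hinner H (A (A x)) z - 2 * ?a * hinner H (A x) z
        + ?a * ?a * hinner H x z"
      using x z b by (simp add: S_def A_lin field_simps)
    \<comment> \<open>The product of the endpoints \<open>a + b = 1\<close> and
      \<open>a - b = r\<^sup>2\<close>. With their sum \<open>2 a = 1 + r\<^sup>2\<close> it turns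
      \<open>b\<^sup>2 - (A - a)\<^sup>2\<close> into
      \<open>(1 - A) (A - r\<^sup>2)\<close>.\<close>
    have "?a * ?a - ?b * ?b = complex_of_real (r\<^sup>2)"
      by (simp only: flip: of_real_mult of_real_diff) (simp add: a_def b_def power2_eq_square field_simps)
    then have aabb: "?b * ?b = ?a * ?a - complex_of_real (r\<^sup>2)" by (simp add: algebra_simps)
    have two_a: "complex_of_real (1 + r\<^sup>2) = 2 * ?a" by (simp add: a_def)
    have "hinner H (G (G x)) z = ?b * ?b * hinner H x z - ?b * ?b * hinner H (S (S x)) z"
      using x z by (simp add: G_eq is_bop_scale[OF self_adjointD(1)[OF R]] RR B_def algebra_simps)
    also have "\<dots> = 2 * ?a * hinner H (A x) z - hinner H (A (A x)) z - complex_of_real (r\<^sup>2) * hinner H x z"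
      unfolding SS unfolding aabb by (simp add: algebra_simps)
    finally show "hinner H (G (G x)) z =
        hinner H (hdiff H (hdiff H (hscale H (of_real (1 + r\<^sup>2)) (A x)) (A (A x))) (hscale H (of_real (r\<^sup>2)) x)) z"
      unfolding two_a using x z by simp
  qed (use x self_adjointD(2)[OF G] in auto)
  ultimately show ?thesis using G by (intro exI[of _ G]) simp
qed

theorem class_C1r_imp_dilation:
  assumes r: "0 < r" "r < 1" and T: "class_C1r H r T"
  shows "\<exists>(K :: (int \<Rightarrow> 'a) hspace) V J.
    is_hilbert K \<and> is_isometry H K V \<and> hinvertible K J \<and> class_calC1r K r J \<and>
    (\<forall>n. \<forall>x\<in>hcarrier H. hzpow H T n x = hadj H K V (hzpow K J n (V x)))"
proof -

  \<comment> \<open>The operators on the original space\<close>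
  define K where "K = hdouble H"
  interpret K: hilbert K unfolding K_def by (rule hilbert.intro[OF is_hilbert_hdouble])
  interpret HH: hilbert_pair H H ..
  interpret HK: hilbert_pair H K ..
  interpret KK: hilbert_pair K K ..
  define Ti where "Ti = hinv H T"
  define Ts where "Ts = hadj H H T"
  define W where "W = hadj H H Ti"
  have inv: "hinvertible H T" using T by (simp add: class_C1r_def)
  have bT: "is_bop H H T" using inv by (simp add: hinvertible_def is_operator_def)
  have bTi: "is_bop H H Ti"
    using hinv_works(1)[OF inv] by (simp add: Ti_def is_operator_def)
  have bTs: "is_bop H H Ts" unfolding Ts_def by (rule HH.is_bop_hadj[OF bT])
  have bW: "is_bop H H W" unfolding W_def by (rule HH.is_bop_hadj[OF bTi])
  note [simp] = is_bop_closed[OF bT] is_bop_closed[OF bTi] is_bop_closed[OF bTs] is_bop_closed[OF bW]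
  have TiT [simp]: "Ti (T x) = x" and TTi [simp]: "T (Ti x) = x" if "x \<in> hcarrier H" for x
    using hinv_works(2,3)[OF inv that] by (simp_all add: Ti_def)
  note Ts = HH.inner_hadj_right[OF bT, folded Ts_def] HH.inner_hadj_left[OF bT, folded Ts_def]
  note W = HH.inner_hadj_right[OF bTi, folded W_def] HH.inner_hadj_left[OF bTi, folded W_def]
  have TsW [simp]: "Ts (W x) = x" and WTs [simp]: "W (Ts x) = x" if "x \<in> hcarrier H" for x
    by (rule inner_ext; use that in \<open>simp add: Ts W\<close>)+
  define A where "A = (\<lambda>x. Ts (T x))"
  \<comment> \<open>\<open>M\<close> is the inverse of \<open>A\<close>. Since \<open>W\<close> is
    the adjoint of the inverse of \<open>T\<close>, the products of \<open>W\<close> and its adjoint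
    arising in \<open>Js (J f)\<close> collapse to \<open>M\<close>.\<close>
  define M where "M = (\<lambda>x. Ti (W x))"
  have A: "self_adjoint H A" and M: "self_adjoint H M"
    using is_bop_comp[OF hilbert_axioms hilbert_axioms bT bTs]
      is_bop_comp[OF hilbert_axioms hilbert_axioms bW bTi]
    by (simp_all add: self_adjoint_def is_operator_def A_def M_def Ts flip: W)
  have AM: "A (M x) = x" and MA: "M (A x) = x" if "x \<in> hcarrier H" for x
    using that by (simp_all add: A_def M_def)
  have norm_T: "hnorm H (T x) \<le> hnorm H x" if "x \<in> hcarrier H" for x
    using hopnorm_le_iff[OF hilbert_axioms hilbert_axioms bT, of 1] T that
    by (simp add: class_C1r_def)
  have norm_Ti: "r * hnorm H (Ti x) \<le> hnorm H x" if "x \<in> hcarrier H" for x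
    using hopnorm_le_iff[OF hilbert_axioms hilbert_axioms HH.is_bop_scaled[OF bTi], of 1 "complex_of_real r"]
      T that r by (simp add: class_C1r_def flip: Ti_def)
  have form: "Re (hinner H (A x) x) = (hnorm H (T x))\<^sup>2" if "x \<in> hcarrier H" for x
    using that by (simp add: A_def Ts norm_square)
  have le: "\<forall>x\<in>hcarrier H. Re (hinner H (A x) x) \<le> (hnorm H x)\<^sup>2"
    by (simp add: form norm_T power_mono)
  have ge: "\<forall>x\<in>hcarrier H. r\<^sup>2 * (hnorm H x)\<^sup>2 \<le> Re (hinner H (A x) x)"
  proof
    fix x assume x: "x \<in> hcarrier H"
    \<comment> \<open>The bound on the inverse of \<open>T\<close>, taken at \<open>T x\<close>, is
      a lower bound for \<open>T\<close>.\<close>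
    have "(r * hnorm H x)\<^sup>2 \<le> (hnorm H (T x))\<^sup>2"
      using norm_Ti[of "T x"] x r by (intro power_mono) auto
    then show "r\<^sup>2 * (hnorm H x)\<^sup>2 \<le> Re (hinner H (A x) x)"
      using form[OF x] by (simp add: power_mult_distrib)
  qed
  from defect_square_root[OF A r ge le] obtain G where G: "self_adjoint H G"
    and AG: "\<forall>x\<in>hcarrier H. A (G x) = G (A x)"
    and GG: "\<forall>x\<in>hcarrier H. G (G x) =
      hdiff H (hdiff H (hscale H (of_real (1 + r\<^sup>2)) (A x)) (A (A x))) (hscale H (of_real (r\<^sup>2)) x)"
    by (elim exE conjE)
  note [simp] = self_adjointD(2)[OF A] self_adjointD(2)[OF M] self_adjointD(2)[OF G]
  note bG = self_adjointD(1)[OF G] and bM = self_adjointD(1)[OF M]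
  have GM: "G (M x) = M (G x)" if x: "x \<in> hcarrier H" for x
  proof -
    have "G (M x) = M (A (G (M x)))" using x by (simp add: MA)
    also have "A (G (M x)) = G x" using x by (simp add: AG AM)
    finally show ?thesis .
  qed

  \<comment> \<open>The triangular operator, its adjoint and its inverse\<close>
  define rc where "rc = complex_of_real r"
  have rc: "rc \<noteq> 0" "cnj rc = rc" using r by (simp_all add: rc_def)
  define Z where "Z = (\<lambda>x::'a. hzero H)"
  define J where "J = hblock H T Z (\<lambda>x. W (G x)) (\<lambda>x. hscale H rc (W x))"
  \<comment> \<open>The transposed matrix of adjoints: \<open>G\<close> is self-adjoint,
    \<open>rc\<close> is real, and \<open>W\<close> has adjoint \<open>Ti\<close>.\<close>
  define Js where "Js = hblock H Ts (\<lambda>x. G (Ti x)) Z (\<lambda>x. hscale H rc (Ti x))"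
  \<comment> \<open>The inverse of a lower triangular matrix; in its corner entry \<open>Ts\<close>
    and \<open>W\<close> cancel, leaving \<open>G\<close> after \<open>Ti\<close> up to a
    scalar.\<close>
  define Ji where "Ji = hblock H Ti Z (\<lambda>x. hscale H (- 1 / rc) (G (Ti x))) (\<lambda>x. hscale H (1 / rc) (Ts x))"
  note comp = is_bop_comp[OF hilbert_axioms hilbert_axioms]
  have bZ: "is_bop H H Z" unfolding Z_def by (rule HH.is_bop_zero)
  have bJ: "is_bop K K J" and bJs: "is_bop K K Js" and bJi: "is_bop K K Ji"
    unfolding J_def Js_def Ji_def K_def
    by (intro is_bop_hblock HH.is_bop_scaled bZ bT bTi bTs comp[OF bG bW] comp[OF bTi bG] bW)+
  have [simp]: "Z x = hzero H" for x by (simp add: Z_def)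
  have zero_left [simp]: "hadd H (hzero H) x = x" if "x \<in> hcarrier H" for x
    using that add_commute[of x "hzero H"] by simp
  note lin = is_bop_add[OF bT] is_bop_add[OF bTi] is_bop_add[OF bTs] is_bop_add[OF bW] is_bop_add[OF bG] is_bop_add[OF bM]
    is_bop_scale[OF bT] is_bop_scale[OF bTi] is_bop_scale[OF bTs] is_bop_scale[OF bW] is_bop_scale[OF bG] is_bop_scale[OF bM]
    is_bop_diff[OF hilbert_axioms bG] is_bop_diff[OF hilbert_axioms bM]
  have adj: "hinner K (J f) g = hinner K f (Js g)" if "f \<in> hcarrier K" "g \<in> hcarrier K" for f g
    using that unfolding K_def
    by (auto elim!: hdouble_cases simp: J_def Js_def hblock_def Ts W rc self_adjointD(3)[OF G] algebra_simps)
  have JiJ: "Ji (J f) = f" if closed: "f \<in> hcarrier K" for f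
  proof -
    obtain x y where f: "f = hpair H x y" and xy: "x \<in> hcarrier H" "y \<in> hcarrier H"
      using closed unfolding K_def by (rule hdouble_cases)
    have "hadd H (hscale H (- 1 / rc) (G x)) (hscale H (1 / rc) (hadd H (G x) (hscale H rc y))) = y"
      by (rule inner_ext) (use xy rc in \<open>simp_all add: field_simps\<close>)
    then show ?thesis using xy by (simp add: f Ji_def J_def hblock_def lin)
  qed
  have JJi: "J (Ji f) = f" if closed: "f \<in> hcarrier K" for f
  proof -
    obtain x y where f: "f = hpair H x y" and xy: "x \<in> hcarrier H" "y \<in> hcarrier H"
      using closed unfolding K_def by (rule hdouble_cases)
    have "hadd H (W (G (Ti x))) (hscale H rc (hadd H (hscale H (- 1 / rc) (W (G (Ti x)))) (hscale H (1 / rc) y))) = y"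
      by (rule inner_ext) (use xy rc in \<open>simp_all add: field_simps\<close>)
    then show ?thesis using xy by (simp add: f Ji_def J_def hblock_def lin)
  qed
  have invJ: "hinvertible K J"
    using bJ bJi JiJ JJi by (auto simp: hinvertible_def is_operator_def)
  have hinvJ: "hinv K J f = Ji f" if "f \<in> hcarrier K" for f
    by (rule hinv_eqI[OF invJ is_bop_closed[OF bJi that] JJi[OF that]])
  have hadjJ: "hadj K K J f = Js f" if "f \<in> hcarrier K" for f
    by (rule KK.hadj_eqI[OF bJs adj that])

  \<comment> \<open>The quadratic equation\<close>
  define L where "L = (\<lambda>f. Js (J f))"
  have L: "self_adjoint K L"
    unfolding self_adjoint_def is_operator_def
  proof (intro conjI ballI)
    show "is_bop K K L" unfolding L_def
      by (rule is_bop_comp[OF K.hilbert_axioms K.hilbert_axioms bJ bJs])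
    fix f g assume fg: "f \<in> hcarrier K" "g \<in> hcarrier K"
    note closed = is_bop_closed[OF bJ] is_bop_closed[OF bJs]
    have "hinner K (L f) g = cnj (hinner K (J g) (J f))"
      using adj[of g "J f"] fg closed K.inner_commute[of g "L f"] by (simp add: L_def del: hdouble_simps)
    also have "\<dots> = hinner K (J f) (J g)"
      using K.inner_commute[of "J g" "J f"] fg closed by simp
    also have "\<dots> = hinner K f (L g)"
      using adj[of f "J g"] fg closed by (simp add: L_def)
    finally show "hinner K (L f) g = hinner K f (L g)" .
  qed
  define s where "s = complex_of_real (r\<^sup>2)"
  have s: "rc * rc = s" by (simp add: rc_def s_def power2_eq_square)
  \<comment> \<open>The first diagonal entry starts as \<open>A + M G\<^sup>2\<close>. Inserting
    \<open>G\<^sup>2\<close> cancels \<open>A\<close> and leaves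
    \<open>(1 + s) - s M\<close>.\<close>
  have L_eq: "L (hpair H x y) =
      hpair H (hadd H (hdiff H (hscale H (1 + s) x) (hscale H s (M x))) (hscale H rc (M (G y))))
        (hadd H (hscale H rc (M (G x))) (hscale H s (M y)))"
    if x: "x \<in> hcarrier H" and y: "y \<in> hcarrier H" for x y
  proof -
    have 1: "hadd H (A x) (hadd H (M (G (G x))) (hscale H rc (M (G y))))
      = hadd H (hdiff H (hscale H (1 + s) x) (hscale H s (M x))) (hscale H rc (M (G y)))"
      by (rule inner_ext) (use x y in \<open>simp_all add: GG lin MA s_def algebra_simps\<close>)
    have 2: "hscale H rc (hadd H (M (G x)) (hscale H rc (M y)))
      = hadd H (hscale H rc (M (G x))) (hscale H s (M y))"
      by (rule inner_ext) (use x y in \<open>simp_all add: s[symmetric] algebra_simps\<close>)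
    have "L (hpair H x y) = hpair H (hadd H (A x) (hadd H (M (G (G x))) (hscale H rc (M (G y)))))
        (hscale H rc (hadd H (M (G x)) (hscale H rc (M y))))"
      using x y by (simp add: L_def Js_def J_def hblock_def lin A_def M_def flip: GM[unfolded M_def])
    then show ?thesis by (simp add: 1 2)
  qed
  \<comment> \<open>Cayley-Hamilton for a matrix with commuting entries: by \<open>L_eq\<close> the
    trace is \<open>1 + s\<close>, and inserting \<open>G\<^sup>2\<close> shows that the determinant
    is \<open>s\<close>. The proof checks the two coordinates directly.\<close>
  have quad: "L (L f) = hdiff K (hscale K (complex_of_real (1 + r\<^sup>2)) (L f)) (hscale K (complex_of_real (r\<^sup>2)) f)"
    if f: "f \<in> hcarrier K" for f
  proof -
    obtain x y where f: "f = hpair H x y" and xy: "x \<in> hcarrier H" "y \<in> hcarrier H"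
      using f unfolding K_def by (rule hdouble_cases)
    have s1: "complex_of_real (1 + r\<^sup>2) = 1 + s" "complex_of_real (r\<^sup>2) = s" by (simp_all add: s_def)
    have G2: "G (G z) = hdiff H (hdiff H (hscale H (1 + s) (A z)) (A (A z))) (hscale H s z)"
      if "z \<in> hcarrier H" for z using GG[rule_format, OF that] by (simp only: s1)
    have ss: "rc * (rc * c) = s * c" for c using s by (simp add: mult.assoc[symmetric])
    show ?thesis
      unfolding f s1 K_def using xy
      by (simp add: L_eq)
        (intro conjI; rule inner_ext; simp add: lin GM G2 MA ss algebra_simps)
  qed
  have calC: "class_calC1r K r J"
  proof -
    have "r\<^sup>2 \<noteq> 1" using r by (simp add: power2_eq_1_iff)
    from K.quadratic_spectral_decomposition[OF L this quad]
    show ?thesis using bJ is_bop_closed[OF bJ] by (simp add: class_calC1r_def is_operator_def hadjJ L_def)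
  qed

  \<comment> \<open>The embedding and the integer powers\<close>
  define V where "V x = hpair H x (hzero H)" for x
  have V_closed: "V x \<in> hcarrier K" if "x \<in> hcarrier H" for x
    using that by (simp add: V_def K_def)
  have V_norm: "hnorm K (V x) = hnorm H x" if "x \<in> hcarrier H" for x
    using that by (simp add: V_def K_def hnorm_hdouble)
  have zeros: "hscale H a (hzero H) = hzero H" for a
    by (rule inner_ext) simp_all
  have isoV: "is_isometry H K V"
    using V_closed V_norm
    by (auto simp: is_isometry_def is_bop_def intro!: exI[of _ 1]) (simp_all add: K_def V_def zeros)
  then have bV: "is_bop H K V" by (simp add: is_isometry_def)
  have adjV: "hinner K (V x) f = hinner H x (f 0)" if "x \<in> hcarrier H" "f \<in> hcarrier K" for x f
    using that by (simp add: K_def V_def)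
  have bV': "is_bop K H (\<lambda>f. f 0)"
    by (rule HK.is_bop_adjointI[OF bV _ adjV]) (simp_all add: K_def)
  have hadjV: "hadj H K V f = f 0" if "f \<in> hcarrier K" for f
    by (rule HK.hadj_eqI[OF bV' adjV that])
  \<comment> \<open>The zero upper right entries make the first coordinate evolve by itself, and the
    adjoint of \<open>V\<close> reads off exactly this coordinate.\<close>
  have J_0: "J f 0 = T (f 0)" and Ji_0: "Ji f 0 = Ti (f 0)" if "f \<in> hcarrier K" for f
    using hdouble_closed[OF that[unfolded K_def]] by (simp_all add: J_def Ji_def hblock_def)
  have pow: "(J ^^ k) (V x) \<in> hcarrier K \<and> (J ^^ k) (V x) 0 = (T ^^ k) x \<and> (T ^^ k) x \<in> hcarrier H"
    if x: "x \<in> hcarrier H" for x k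
  proof (induction k)
    case (Suc k)
    then show ?case using is_bop_closed[OF bJ] by (simp add: J_0)
  qed (use x in \<open>simp add: V_closed, simp add: V_def\<close>)
  have pow_inv: "(hinv K J ^^ k) (V x) \<in> hcarrier K \<and> (hinv K J ^^ k) (V x) 0 = (Ti ^^ k) x
      \<and> (Ti ^^ k) x \<in> hcarrier H" if x: "x \<in> hcarrier H" for x k
  proof (induction k)
    case (Suc k)
    then show ?case using is_bop_closed[OF bJi] by (simp add: hinvJ Ji_0)
  qed (use x in \<open>simp add: V_closed, simp add: V_def\<close>)
  have "hzpow H T n x = hadj H K V (hzpow K J n (V x))" if "x \<in> hcarrier H" for n x
    using pow[OF that] pow_inv[OF that] by (simp add: hzpow_def hadjV Ti_def)
  then show ?thesis
    using K.hilbert isoV invJ calC by blast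
qed

end

text \<open>Since \<open>J\<^sup>* J = P\<^sub>0 + r\<^sup>2 P\<^sub>1\<close>, one has
  \<open>\<parallel>J f\<parallel>\<^sup>2 = \<parallel>P\<^sub>0 f\<parallel>\<^sup>2 + r\<^sup>2 \<parallel>P\<^sub>1 f\<parallel>\<^sup>2\<close>, while \<open>\<parallel>f\<parallel>\<^sup>2 = \<parallel>P\<^sub>0 f\<parallel>\<^sup>2 + \<parallel>P\<^sub>1 f\<parallel>\<^sup>2\<close>.\<close>

lemma (in hilbert) class_calC1r_bounds:
  assumes r: "0 < r" "r < 1" and J: "class_calC1r H r J" and x: "x \<in> hcarrier H"
  shows "hnorm H (J x) \<le> hnorm H x" "r * hnorm H x \<le> hnorm H (J x)"
proof -
  interpret HH: hilbert_pair H H ..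
  obtain P0 P1 where P: "is_orth_proj H P0" "is_orth_proj H P1"
    and sum: "hadd H (P0 x) (P1 x) = x"
    and JJ: "hadj H H J (J x) = hadd H (P0 x) (hscale H (complex_of_real (r\<^sup>2)) (P1 x))"
    using J x unfolding class_calC1r_def by blast
  have bJ: "is_bop H H J" using J by (simp add: class_calC1r_def is_operator_def)
  have bP: "is_bop H H P0" "is_bop H H P1"
    using P by (simp_all add: is_orth_proj_def is_operator_def)
  note closed = is_bop_closed[OF bJ x] is_bop_closed[OF bP(1) x] is_bop_closed[OF bP(2) x]
  define p where "p = (hnorm H (P0 x))\<^sup>2"
  define q where "q = (hnorm H (P1 x))\<^sup>2"
  have nonneg: "p \<ge> 0" "q \<ge> 0" by (simp_all add: p_def q_def)
  have r2: "0 \<le> r\<^sup>2" "r\<^sup>2 \<le> 1" using r by (simp_all add: power_le_one)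
  have inner: "hinner H (P0 x) x = of_real p" "hinner H (P1 x) x = of_real q"
    using P x by (simp_all add: orth_proj_inner p_def q_def)
  have "hinner H x x = hinner H (hadd H (P0 x) (P1 x)) x" by (simp only: sum)
  then have nx: "(hnorm H x)\<^sup>2 = p + q"
    using x closed inner by (simp add: norm_square)
  have "hinner H (J x) (J x) = hinner H (hadj H H J (J x)) x"
    using x closed by (simp add: HH.inner_hadj_left[OF bJ])
  then have nJ: "(hnorm H (J x))\<^sup>2 = p + r\<^sup>2 * q"
    using x closed inner by (simp add: norm_square JJ)
  have "r\<^sup>2 * q \<le> q" using r2 nonneg by (simp add: mult_left_le_one_le)
  then have "(hnorm H (J x))\<^sup>2 \<le> (hnorm H x)\<^sup>2" by (simp add: nx nJ)
  then show "hnorm H (J x) \<le> hnorm H x" by (rule power2_le_imp_le) (use x in simp)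
  have "r\<^sup>2 * p \<le> p" using r2 nonneg by (simp add: mult_left_le_one_le)
  then have "(r * hnorm H x)\<^sup>2 \<le> (hnorm H (J x))\<^sup>2"
    by (simp add: nx nJ power_mult_distrib distrib_left)
  then show "r * hnorm H x \<le> hnorm H (J x)" by (rule power2_le_imp_le) (use closed in simp)
qed

text \<open>Moving one adjoint across the inner product and using Cauchy-Schwarz leaves a factor
  \<open>hnorm K (V x)\<close>, which the isometry turns into \<open>hnorm H x\<close> for
  \<open>x = hadj H K V y\<close>.\<close>

lemma (in hilbert_pair) norm_hadj_isometry_le:
  assumes V: "is_isometry H K V" and y: "y \<in> hcarrier K"
  shows "hnorm H (hadj H K V y) \<le> hnorm K y"
proof (rule H.norm_le_if_inner_le)
  have bV: "is_bop H K V" using V by (simp add: is_isometry_def)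
  let ?x = "hadj H K V y"
  show x: "?x \<in> hcarrier H" by (rule is_bop_closed[OF is_bop_hadj[OF bV] y])
  have "hinner H ?x ?x = hinner K (V ?x) y" using x y by (simp add: inner_hadj_right[OF bV])
  then have "cmod (hinner H ?x ?x) \<le> hnorm K (V ?x) * hnorm K y"
    using K.cauchy_schwarz[OF is_bop_closed[OF bV x] y] by simp
  then show "cmod (hinner H ?x ?x) \<le> hnorm K y * hnorm H ?x"
    using V x by (simp add: is_isometry_def mult.commute)
qed (use y in simp)

text \<open>Exponents \<open>1\<close> and \<open>-1\<close> exhibit \<open>T\<close> and its
  inverse as compressions. The upper bound for \<open>J\<close> at \<open>V x\<close> handles
  \<open>T\<close>; the lower bound at \<open>hinv K J (V x)\<close> handles the inverse.\<close>

theorem (in hilbert_pair) dilation_imp_class_C1r: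
  assumes r: "0 < r" "r < 1" and T: "hinvertible H T"
    and V: "is_isometry H K V" and invJ: "hinvertible K J" and J: "class_calC1r K r J"
    and pow: "\<And>n x. x \<in> hcarrier H \<Longrightarrow> hzpow H T n x = hadj H K V (hzpow K J n (V x))"
  shows "class_C1r H r T"
proof -
  interpret HH: hilbert_pair H H ..
  have bT: "is_bop H H T" and bTi: "is_bop H H (hinv H T)"
    using T hinv_works(1)[OF T] by (simp_all add: hinvertible_def is_operator_def)
  have bV: "is_bop H K V" and V_norm: "\<And>x. x \<in> hcarrier H \<Longrightarrow> hnorm K (V x) = hnorm H x"
    using V by (simp_all add: is_isometry_def)
  have bJ: "is_bop K K J" and bJi: "is_bop K K (hinv K J)"
    using invJ hinv_works(1)[OF invJ] by (simp_all add: hinvertible_def is_operator_def)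
  have "hnorm H (T x) \<le> 1 * hnorm H x" if x: "x \<in> hcarrier H" for x
  proof -
    have Vx: "V x \<in> hcarrier K" by (rule is_bop_closed[OF bV x])
    have "T x = hadj H K V (J (V x))" using pow[OF x, of 1] by (simp add: hzpow_def)
    then have "hnorm H (T x) \<le> hnorm K (J (V x))"
      using norm_hadj_isometry_le[OF V is_bop_closed[OF bJ Vx]] by simp
    also have "\<dots> \<le> hnorm K (V x)" by (rule K.class_calC1r_bounds[OF r J Vx])
    finally show ?thesis by (simp add: V_norm[OF x])
  qed
  moreover have "hnorm H (hscale H (complex_of_real r) (hinv H T x)) \<le> 1 * hnorm H x"
    if x: "x \<in> hcarrier H" for x
  proof -
    have Vx: "V x \<in> hcarrier K" by (rule is_bop_closed[OF bV x])
    have JVx: "hinv K J (V x) \<in> hcarrier K" by (rule is_bop_closed[OF bJi Vx])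
    have "hinv H T x = hadj H K V (hinv K J (V x))" using pow[OF x, of "- 1"] by (simp add: hzpow_def)
    then have "hnorm H (hinv H T x) \<le> hnorm K (hinv K J (V x))"
      using norm_hadj_isometry_le[OF V JVx] by simp
    then have "r * hnorm H (hinv H T x) \<le> r * hnorm K (hinv K J (V x))"
      using r by simp
    also have "\<dots> \<le> hnorm K (J (hinv K J (V x)))" by (rule K.class_calC1r_bounds[OF r J JVx])
    also have "\<dots> = hnorm H x" by (simp add: hinv_works(3)[OF invJ Vx] V_norm[OF x])
    finally show ?thesis using r is_bop_closed[OF bTi x] by simp
  qed
  ultimately show ?thesis
    using T hopnorm_le_iff[OF H.hilbert_axioms H.hilbert_axioms bT, of 1]
      hopnorm_le_iff[OF H.hilbert_axioms H.hilbert_axioms HH.is_bop_scaled[OF bTi], of 1 "complex_of_real r"]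
    by (simp add: class_C1r_def)
qed

text \<open>Types cannot be quantified existentially, so the dilation is asserted on the concrete
  type \<open>int \<Rightarrow> 'h\<close>, while the converse admits spaces over an arbitrary type
  \<open>'k\<close>.\<close>

theorem theorem2p4:
  fixes H :: "'h hspace" and T :: "'h \<Rightarrow> 'h" and r :: real
  assumes "is_hilbert H" and "0 < r" and "r < 1" and "hinvertible H T"
  shows "(class_C1r H r T \<longrightarrow>
            (\<exists>(K :: (int \<Rightarrow> 'h) hspace) V J.
               is_hilbert K \<and> is_isometry H K V \<and> hinvertible K J \<and> class_calC1r K r J \<and>
               (\<forall>n::int. \<forall>x\<in>hcarrier H. hzpow H T n x = hadj H K V (hzpow K J n (V x)))))
       \<and> (\<forall>(K :: 'k hspace) V J.
               is_hilbert K \<and> is_isometry H K V \<and> hinvertible K J \<and> class_calC1r K r J \<and>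
               (\<forall>n::int. \<forall>x\<in>hcarrier H. hzpow H T n x = hadj H K V (hzpow K J n (V x)))
             \<longrightarrow> class_C1r H r T)"
proof -
  interpret hilbert H by (rule hilbert.intro) fact
  have "class_C1r H r T" if "is_hilbert K" "is_isometry H K V" "hinvertible K J" "class_calC1r K r J"
    "\<forall>n. \<forall>x\<in>hcarrier H. hzpow H T n x = hadj H K V (hzpow K J n (V x))"
    for K :: "'k hspace" and V J
  proof -
    interpret hilbert_pair H K
      by (intro hilbert_pair.intro hilbert_axioms hilbert.intro that)
    show ?thesis
      by (rule dilation_imp_class_C1r[OF assms(2-4) that(2-4)]) (simp add: that(5))
  qed
  then show ?thesis
    using class_C1r_imp_dilation[OF assms(2,3)] by blast
qed

end
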